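(* Let $(W,S)$ be a Coxeter system, let $J\subseteq S$, and let $X\subseteq T$ be an order ideal of $(T,\sqsubseteq)$. Then the map $P^J:W\to W$ is order preserving on $(W,\leqslant_{L^X})$: $u\leqslant_{L^X}v$ implies $P^J(u)\leqslant_{L^X}P^J(v)$. In particular, this holds for the $k$-intermediate orders $\leqslant_{L^k}$, for every $k\in\mathbb N$.
   Context: $(W,S)$ is a Coxeter system with length function $\ell$, reflections $T=\{wsw^{-1}:w\in W,\ s\in S\}$ and Bruhat order $\leqslant$. For $X\subseteq T$, $u\leqslant_{L^X}v$ iff $u=v$, or $\ell(u)<\ell(v)$ and there exist $t_1,\dots,t_r\in X$ with $u<t_1u<\dots<t_r\cdots t_1u=v$ in the Bruhat order. For $k\in\mathbb N$, let $T_k=\{t\in T:(\ell(t)-1)/2\leqslant k\}$ and $\leqslant_{L^k}:=\leqslant_{L^{T_k}}$. The Bruhat graph $\Omega_{W,S}$ has vertex set $W$ and an arrow $u\to v$ iff $uv^{-1}\in T$ and $u<v$; $\Omega_{W,S}(Y)$ is its induced subgraph on $Y$. A reflection subgroup $W'$ (a subgroup generated by reflections) has canonical Coxeter generators $S'=\{t\in T:N(t)\cap W'=\{t\}\}$, where $N(v)=\{t\in T:\ell(tv)<\ell(v)\}$; it is dihedral if $|S'|=2$. $t\sqsubseteq' t'$ iff $t=t'$ or there is a dihedral reflection subgroup $W'\ni t,t'$ such that the directed distance from $t$ to $t'$ in $\Omega_{W,S}(W')$ is finite; $\sqsubseteq$ is the transitive closure of $\sqsubseteq'$. For $J\subseteq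 S$, $W_J$ is the subgroup generated by $J$ and $W^J=\{w\in W:\ell(w)<\ell(ws)\ \forall s\in J\}$. Every $w$ factors uniquely as $w=w^Jw_J$ with $w^J\in W^J$, $w_J\in W_J$ and $\ell(w)=\ell(w^J)+\ell(w_J)$. Set $P^J(w):=w^J$. *)

theory Defs
  imports "HOL-Algebra.Algebra"
begin

definition wprod :: "('a, 'b) monoid_scheme \<Rightarrow> 'a list \<Rightarrow> 'a" where
  "wprod G ws = foldr (\<lambda>x y. x \<otimes>\<^bsub>G\<^esub> y) ws \<one>\<^bsub>G\<^esub>"

definition alt_word :: "'a \<Rightarrow> 'a \<Rightarrow> nat \<Rightarrow> 'a list" where
  "alt_word s t n = map (\<lambda>i. if even i then s else t) [0..<n]"

text \<open>One elementary move of the Coxeter presentation: deleting a relator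
  (s t)^m(s,t), where m(s,t) is the (finite) order of st; for s = t this is s s.\<close>
definition cox_move :: "('a, 'b) monoid_scheme \<Rightarrow> 'a set \<Rightarrow> 'a list \<Rightarrow> 'a list \<Rightarrow> bool" where
  "cox_move G S x y \<longleftrightarrow> (\<exists>u v s t. s \<in> S \<and> t \<in> S \<and> group.ord G (s \<otimes>\<^bsub>G\<^esub> t) > 0 \<and>
      x = u @ alt_word s t (2 * group.ord G (s \<otimes>\<^bsub>G\<^esub> t)) @ v \<and> y = u @ v)"

text \<open>(W,S) is a Coxeter system: S is a generating set of involutions of the group W
  and W has the presentation with generators S and relations (st)^m(s,t) = 1,
  i.e. every word in S representing the identity is a consequence of the relators.\<close>
definition coxeter_system :: "('a, 'b) monoid_scheme \<Rightarrow> 'a set \<Rightarrow> bool" where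
  "coxeter_system G S \<longleftrightarrow> group G \<and> S \<subseteq> carrier G \<and> generate G S = carrier G \<and>
     (\<forall>s\<in>S. s \<noteq> \<one>\<^bsub>G\<^esub> \<and> s \<otimes>\<^bsub>G\<^esub> s = \<one>\<^bsub>G\<^esub>) \<and>
     (\<forall>ws \<in> lists S. wprod G ws = \<one>\<^bsub>G\<^esub> \<longrightarrow> equivclp (cox_move G S) ws [])"

definition cox_len :: "('a, 'b) monoid_scheme \<Rightarrow> 'a set \<Rightarrow> 'a \<Rightarrow> nat" where
  "cox_len G S w = (LEAST n. \<exists>ws \<in> lists S. length ws = n \<and> wprod G ws = w)"

definition reflections :: "('a, 'b) monoid_scheme \<Rightarrow> 'a set \<Rightarrow> 'a set" where
  "reflections G S = {w \<otimes>\<^bsub>G\<^esub> s \<otimes>\<^bsub>G\<^esub> inv\<^bsub>G\<^esub> w | w s. w \<in> carrier G \<and> s \<in> S}"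

definition bruhat_step :: "('a, 'b) monoid_scheme \<Rightarrow> 'a set \<Rightarrow> 'a \<Rightarrow> 'a \<Rightarrow> bool" where
  "bruhat_step G S u v \<longleftrightarrow> u \<in> carrier G \<and> v \<in> carrier G \<and>
     (\<exists>t \<in> reflections G S. v = t \<otimes>\<^bsub>G\<^esub> u) \<and> cox_len G S u < cox_len G S v"

definition bruhat_le :: "('a, 'b) monoid_scheme \<Rightarrow> 'a set \<Rightarrow> 'a \<Rightarrow> 'a \<Rightarrow> bool" where
  "bruhat_le G S u v \<longleftrightarrow> u \<in> carrier G \<and> v \<in> carrier G \<and> (bruhat_step G S)\<^sup>*\<^sup>* u v"

definition bruhat_lt :: "('a, 'b) monoid_scheme \<Rightarrow> 'a set \<Rightarrow> 'a \<Rightarrow> 'a \<Rightarrow> bool" where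
  "bruhat_lt G S u v \<longleftrightarrow> bruhat_le G S u v \<and> u \<noteq> v"

definition LX_step :: "('a, 'b) monoid_scheme \<Rightarrow> 'a set \<Rightarrow> 'a set \<Rightarrow> 'a \<Rightarrow> 'a \<Rightarrow> bool" where
  "LX_step G S R x y \<longleftrightarrow> (\<exists>t \<in> R. y = t \<otimes>\<^bsub>G\<^esub> x \<and> bruhat_lt G S x y)"

definition le_LX :: "('a, 'b) monoid_scheme \<Rightarrow> 'a set \<Rightarrow> 'a set \<Rightarrow> 'a \<Rightarrow> 'a \<Rightarrow> bool" where
  "le_LX G S R u v \<longleftrightarrow> u = v \<or> (cox_len G S u < cox_len G S v \<and> (LX_step G S R)\<^sup>+\<^sup>+ u v)"

definition refl_T_k :: "('a, 'b) monoid_scheme \<Rightarrow> 'a set \<Rightarrow> nat \<Rightarrow> 'a set" where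
  "refl_T_k G S k = {t \<in> reflections G S. (real (cox_len G S t) - 1) / 2 \<le> real k}"

definition le_Lk :: "('a, 'b) monoid_scheme \<Rightarrow> 'a set \<Rightarrow> nat \<Rightarrow> 'a \<Rightarrow> 'a \<Rightarrow> bool" where
  "le_Lk G S k = le_LX G S (refl_T_k G S k)"

definition bruhat_arrow :: "('a, 'b) monoid_scheme \<Rightarrow> 'a set \<Rightarrow> 'a \<Rightarrow> 'a \<Rightarrow> bool" where
  "bruhat_arrow G S u v \<longleftrightarrow> u \<otimes>\<^bsub>G\<^esub> inv\<^bsub>G\<^esub> v \<in> reflections G S \<and> bruhat_lt G S u v"

definition bruhat_arrow_on :: "('a, 'b) monoid_scheme \<Rightarrow> 'a set \<Rightarrow> 'a set \<Rightarrow> 'a \<Rightarrow> 'a \<Rightarrow> bool" where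
  "bruhat_arrow_on G S Y u v \<longleftrightarrow> u \<in> Y \<and> v \<in> Y \<and> bruhat_arrow G S u v"

definition left_inversions :: "('a, 'b) monoid_scheme \<Rightarrow> 'a set \<Rightarrow> 'a \<Rightarrow> 'a set" where
  "left_inversions G S v = {t \<in> reflections G S. cox_len G S (t \<otimes>\<^bsub>G\<^esub> v) < cox_len G S v}"

definition reflection_subgroup :: "('a, 'b) monoid_scheme \<Rightarrow> 'a set \<Rightarrow> 'a set \<Rightarrow> bool" where
  "reflection_subgroup G S W' \<longleftrightarrow> (\<exists>R \<subseteq> reflections G S. W' = generate G R)"

definition canonical_gens :: "('a, 'b) monoid_scheme \<Rightarrow> 'a set \<Rightarrow> 'a set \<Rightarrow> 'a set" where
  "canonical_gens G S W' = {t \<in> reflections G S. left_inversions G S t \<inter> W' = {t}}"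

definition dihedral_refl_subgroup :: "('a, 'b) monoid_scheme \<Rightarrow> 'a set \<Rightarrow> 'a set \<Rightarrow> bool" where
  "dihedral_refl_subgroup G S W' \<longleftrightarrow> reflection_subgroup G S W' \<and>
     finite (canonical_gens G S W') \<and> card (canonical_gens G S W') = 2"

definition refl_sq' :: "('a, 'b) monoid_scheme \<Rightarrow> 'a set \<Rightarrow> 'a \<Rightarrow> 'a \<Rightarrow> bool" where
  "refl_sq' G S t t' \<longleftrightarrow> t \<in> reflections G S \<and> t' \<in> reflections G S \<and>
     (t = t' \<or> (\<exists>W'. dihedral_refl_subgroup G S W' \<and> t \<in> W' \<and> t' \<in> W' \<and>
                       (bruhat_arrow_on G S W')\<^sup>*\<^sup>* t t'))"

definition refl_sq :: "('a, 'b) monoid_scheme \<Rightarrow> 'a set \<Rightarrow> 'a \<Rightarrow> 'a \<Rightarrow> bool" where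
  "refl_sq G S = (refl_sq' G S)\<^sup>+\<^sup>+"

definition order_ideal_T :: "('a, 'b) monoid_scheme \<Rightarrow> 'a set \<Rightarrow> 'a set \<Rightarrow> bool" where
  "order_ideal_T G S R \<longleftrightarrow> R \<subseteq> reflections G S \<and>
     (\<forall>t t'. t' \<in> R \<longrightarrow> refl_sq G S t t' \<longrightarrow> t \<in> R)"

definition min_coset_reps :: "('a, 'b) monoid_scheme \<Rightarrow> 'a set \<Rightarrow> 'a set \<Rightarrow> 'a set" where
  "min_coset_reps G S J = {w \<in> carrier G. \<forall>s \<in> J. cox_len G S w < cox_len G S (w \<otimes>\<^bsub>G\<^esub> s)}"

definition proj_J :: "('a, 'b) monoid_scheme \<Rightarrow> 'a set \<Rightarrow> 'a set \<Rightarrow> 'a \<Rightarrow> 'a" where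
  "proj_J G S J w = (THE x. x \<in> min_coset_reps G S J \<and>
     (\<exists>y \<in> generate G J. w = x \<otimes>\<^bsub>G\<^esub> y \<and> cox_len G S w = cox_len G S x + cox_len G S y))"

end

theory Submission
  imports Defs
begin

text \<open>
  Deleting a relator from a word changes the number of times that its gallery crosses a given wall
  by an even number. Hence the set \<open>N(w)\<close> of the reflections whose walls are crossed an odd number
  of times depends only on \<open>w\<close>, and \<open>N(xy)\<close> is the symmetric difference of \<open>N(x)\<close> and \<open>x N(y) x\<inverse>\<close>.
  If \<open>t\<close> lies in \<open>N(w)\<close>, then a word of \<open>tw\<close> arises from any word of \<open>w\<close> by deleting a letter, so
  \<open>N(w)\<close> is the set of left inversions. On a coset of a subgroup \<open>H\<close> with shortest element \<open>y\<close>,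
  the rule for \<open>N(xy)\<close> shows that \<open>N(hy)\<close> and \<open>N(h)\<close> have the same trace on \<open>H\<close>.

  The map \<open>P\<^sup>J\<close> does not change if its argument \<open>w\<close> is replaced by the shorter of \<open>w\<close> and \<open>ws\<close>
  with \<open>s\<close> in \<open>J\<close>. By induction on \<open>\<ell>(u) + \<ell>(v)\<close> it suffices that these replacements are monotone.
  For a single step \<open>u < tu\<close> the only nontrivial situation is \<open>x < xs < txs < tx\<close>, where a chain
  from \<open>x\<close> to \<open>txs\<close> with reflections in \<open>X\<close> is required. With \<open>r = xsx\<inverse>\<close> these elements are
  \<open>x < rx < trx < tx\<close>. They lie in one coset of the dihedral group generated by \<open>t\<close> and \<open>r\<close>, hence the
  question can be settled in that group. There \<open>X\<close> contains all reflections that are shorter than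
  \<open>t\<close> with respect to the canonical generators; these are enough to climb along the suffixes of a
  reduced word of the upper end, after at most one jump to the other of the two families of
  alternating words.
\<close>

section \<open>Words in involutions\<close>

lemma alt_word_0 [simp]: "alt_word x y 0 = []"
  by (simp add: alt_word_def)

lemma alt_word_Suc [simp]: "alt_word x y (Suc n) = x # alt_word y x n"
  unfolding alt_word_def by (simp add: upt_conv_Cons map_Suc_upt [symmetric] o_def del: upt_Suc)

lemma length_alt_word [simp]: "length (alt_word x y n) = n"
  by (simp add: alt_word_def)

lemma alt_word_in_lists: "x \<in> A \<Longrightarrow> y \<in> A \<Longrightarrow> alt_word x y n \<in> lists A"
  by (induction n arbitrary: x y) auto

lemma alt_word_add:
  "alt_word x y (m + n) = alt_word x y m @ (if even m then alt_word x y n else alt_word y x n)"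
  by (induction m arbitrary: x y) auto

lemma rev_alt_word: "rev (alt_word x y n) = (if even n then alt_word y x n else alt_word x y n)"
proof (induction n arbitrary: x y)
  case (Suc n)
  show ?case
    using alt_word_add [of x y n 1] alt_word_add [of y x n 1] by (simp add: Suc.IH)
qed simp

lemma rev_in_lists [simp]: "rev ws \<in> lists A \<longleftrightarrow> ws \<in> lists A"
  by (simp add: in_lists_conv_set)

lemma distinct_adj_two_letters:
  assumes "distinct_adj ws" "ws \<in> lists {a, b}"
  obtains x y where "{x, y} = {a, b}" "ws = alt_word x y (length ws)"
  using assms
proof (induction ws arbitrary: thesis)
  case Nil
  then show ?case by simp
next
  case (Cons c ws)
  have "c \<in> {a, b}" and ws: "distinct_adj ws" "ws \<in> lists {a, b}"
    using Cons.prems(2,3) by (auto simp: distinct_adj_Cons)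
  obtain x y where xy: "{x, y} = {a, b}" "ws = alt_word x y (length ws)"
    using Cons.IH [OF _ ws] by blast
  show ?case
  proof (cases ws)
    case Nil
    moreover obtain d where "{c, d} = {a, b}" using \<open>c \<in> {a, b}\<close> by blast
    ultimately show ?thesis using Cons.prems(1) [of c d] by simp
  next
    case (Cons d us)
    then have "d = x" using xy(2) by simp
    then have "c = y" using Cons Cons.prems(2) xy(1) \<open>c \<in> {a, b}\<close> by auto
    then show ?thesis using Cons.prems(1) [of y x] xy by auto
  qed
qed

lemma wprod_Nil [simp]: "wprod G [] = \<one>\<^bsub>G\<^esub>"
  and wprod_Cons [simp]: "wprod G (x # xs) = x \<otimes>\<^bsub>G\<^esub> wprod G xs"
  by (simp_all add: wprod_def)

text \<open>The \<open>i\<close>-th wall of \<open>s\<^sub>1 \<dots> s\<^sub>k\<close> is \<open>s\<^sub>1 \<dots> s\<^sub>i \<dots> s\<^sub>1\<close>.\<close>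

primrec walls :: "('a, 'b) monoid_scheme \<Rightarrow> 'a list \<Rightarrow> 'a list" where
  "walls G [] = []"
| "walls G (s # ws) = s # map (\<lambda>t. s \<otimes>\<^bsub>G\<^esub> t \<otimes>\<^bsub>G\<^esub> inv\<^bsub>G\<^esub> s) (walls G ws)"

definition crosses_oddly :: "('a, 'b) monoid_scheme \<Rightarrow> 'a list \<Rightarrow> 'a \<Rightarrow> bool" where
  "crosses_oddly G ws t \<longleftrightarrow> odd (count_list (walls G ws) t)"

lemma crosses_oddly_Nil [simp]: "\<not> crosses_oddly G [] t"
  by (simp add: crosses_oddly_def)

lemma crosses_oddly_imp_wall: "crosses_oddly G ws t \<Longrightarrow> t \<in> set (walls G ws)"
  by (rule ccontr) (simp add: crosses_oddly_def)

context group
begin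

lemma inv_mult_cancel_left [simp]:
    "x \<in> carrier G \<Longrightarrow> y \<in> carrier G \<Longrightarrow> inv x \<otimes> (x \<otimes> y) = y"
  and mult_inv_cancel_left [simp]:
    "x \<in> carrier G \<Longrightarrow> y \<in> carrier G \<Longrightarrow> x \<otimes> (inv x \<otimes> y) = y"
  by (simp_all add: m_assoc [symmetric])

lemma conj_eq_iff:
  assumes "x \<in> carrier G" "y \<in> carrier G" "t \<in> carrier G"
  shows "x \<otimes> y \<otimes> inv x = t \<longleftrightarrow> y = inv x \<otimes> t \<otimes> x"
  using assms by (auto simp: m_assoc)

lemma wprod_closed [simp]: "ws \<in> lists (carrier G) \<Longrightarrow> wprod G ws \<in> carrier G"
  by (induction ws) auto

lemma wprod_append:
  "us \<in> lists (carrier G) \<Longrightarrow> vs \<in> lists (carrier G) \<Longrightarrow>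
    wprod G (us @ vs) = wprod G us \<otimes> wprod G vs"
  by (induction us) (auto simp: m_assoc)

lemma walls_closed: "ws \<in> lists (carrier G) \<Longrightarrow> walls G ws \<in> lists (carrier G)"
  by (induction ws) (auto simp: in_lists_conv_set)

lemma walls_append:
  assumes "us \<in> lists (carrier G)" "vs \<in> lists (carrier G)"
  shows "walls G (us @ vs) =
    walls G us @ map (\<lambda>t. wprod G us \<otimes> t \<otimes> inv (wprod G us)) (walls G vs)"
  using assms(1)
proof (induction us)
  case Nil
  have "map (\<lambda>t. \<one> \<otimes> t \<otimes> inv \<one>) (walls G vs) = walls G vs"
    using walls_closed [OF assms(2)] by (intro map_idI) (auto simp: in_lists_conv_set)
  then show ?case by simp
next
  case (Cons u us)
  then show ?case
    using walls_closed [OF assms(2)]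
    by (auto simp: in_lists_conv_set m_assoc inv_mult_group)
qed

lemma count_list_map_conj:
  assumes "x \<in> carrier G" "ts \<in> lists (carrier G)" "t \<in> carrier G"
  shows "count_list (map (\<lambda>t. x \<otimes> t \<otimes> inv x) ts) t = count_list ts (inv x \<otimes> t \<otimes> x)"
  using assms(2) by (induction ts) (use assms in \<open>auto simp: conj_eq_iff\<close>)

lemma crosses_oddly_append:
  assumes "us \<in> lists (carrier G)" "vs \<in> lists (carrier G)" "t \<in> carrier G"
  shows "crosses_oddly G (us @ vs) t \<longleftrightarrow>
    crosses_oddly G us t \<noteq> crosses_oddly G vs (inv (wprod G us) \<otimes> t \<otimes> wprod G us)"
  using assms by (simp add: crosses_oddly_def walls_append count_list_map_conj walls_closed)

lemma mult_nat_pow_shift: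
  assumes "x \<in> carrier G" "y \<in> carrier G"
  shows "x \<otimes> (y \<otimes> x) [^] (i::nat) = (x \<otimes> y) [^] i \<otimes> x"
proof (induction i)
  case (Suc i)
  have "x \<otimes> (y \<otimes> x) [^] Suc i = (x \<otimes> (y \<otimes> x) [^] i) \<otimes> (y \<otimes> x)"
    using assms by (simp add: m_assoc)
  then show ?case using assms by (simp add: Suc m_assoc)
qed (use assms in simp)

lemma wprod_alt_word_double:
  assumes "x \<in> carrier G" "y \<in> carrier G"
  shows "wprod G (alt_word x y (2 * n)) = (x \<otimes> y) [^] n"
proof (induction n)
  case (Suc n)
  have "wprod G (alt_word x y (2 * Suc n)) = (x \<otimes> y) \<otimes> (x \<otimes> y) [^] n"
    using assms by (simp add: Suc m_assoc)
  then show ?case using assms by (metis m_closed nat_pow_Suc2)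
qed simp

end

locale involutive_generators = group G for G :: "('a, 'b) monoid_scheme" (structure) +
  fixes A :: "'a set"
  assumes gens_subset: "A \<subseteq> carrier G"
    and gens_square [simp]: "a \<in> A \<Longrightarrow> a \<otimes> a = \<one>"
begin

abbreviation len :: "'a \<Rightarrow> nat" where
  "len \<equiv> cox_len G A"

lemma gens_closed [simp]: "a \<in> A \<Longrightarrow> a \<in> carrier G"
  using gens_subset by blast

lemma gens_inv [simp]: "a \<in> A \<Longrightarrow> inv a = a"
  by (intro inv_equality) auto

lemma gens_cancel [simp]: "a \<in> A \<Longrightarrow> x \<in> carrier G \<Longrightarrow> a \<otimes> (a \<otimes> x) = x"
  by (simp add: m_assoc [symmetric])

lemma gens_mult_eq_one_iff: "a \<in> A \<Longrightarrow> x \<in> carrier G \<Longrightarrow> a \<otimes> x = \<one> \<longleftrightarrow> x = a"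
  using l_cancel [of a x a] by auto

lemma words_closed [simp]: "ws \<in> lists A \<Longrightarrow> ws \<in> lists (carrier G)"
  using gens_subset by auto

lemma generated_subgroup: "subgroup (generate G A) G"
  using gens_subset by (rule generate_is_subgroup)

lemma generated_closed: "w \<in> generate G A \<Longrightarrow> w \<in> carrier G"
  using gens_subset by (rule generate_in_carrier)

lemma inv_wprod: "ws \<in> lists A \<Longrightarrow> inv (wprod G ws) = wprod G (rev ws)"
  by (induction ws) (simp_all add: inv_mult_group wprod_append)

lemma wprod_append_rev_eq_one:
  "us \<in> lists A \<Longrightarrow> vs \<in> lists A \<Longrightarrow> wprod G us = wprod G vs \<Longrightarrow> wprod G (us @ rev vs) = \<one>"
  by (simp add: wprod_append inv_wprod [symmetric])

lemma wprod_in_generate: "ws \<in> lists A \<Longrightarrow> wprod G ws \<in> generate G A"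
  by (induction ws) (auto intro: generate.intros)

lemma word_exists:
  assumes "w \<in> generate G A"
  obtains ws where "ws \<in> lists A" "wprod G ws = w"
  using assms
proof (induction arbitrary: thesis rule: generate.induct)
  case one
  then show ?case using one [of "[]"] by simp
next
  case (incl a)
  then show ?case using incl(2) [of "[a]"] by simp
next
  case (inv a)
  then show ?case using inv(2) [of "[a]"] by simp
next
  case (eng u v)
  obtain us vs where "us \<in> lists A" "wprod G us = u" "vs \<in> lists A" "wprod G vs = v"
    using eng.IH by metis
  then show ?case using eng.prems [of "us @ vs"] by (simp add: wprod_append)
qed

lemma len_wprod_le: "ws \<in> lists A \<Longrightarrow> len (wprod G ws) \<le> length ws"
  unfolding cox_len_def by (rule Least_le) blast

definition reduced :: "'a list \<Rightarrow> bool" where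
  "reduced ws \<longleftrightarrow> ws \<in> lists A \<and> len (wprod G ws) = length ws"

lemma reduced_word_exists:
  assumes "w \<in> generate G A"
  obtains ws where "reduced ws" "wprod G ws = w"
proof -
  have "\<exists>n. \<exists>ws\<in>lists A. length ws = n \<and> wprod G ws = w"
    using word_exists [OF assms] by metis
  from LeastI_ex [OF this] obtain ws
    where "ws \<in> lists A" "length ws = len w" "wprod G ws = w"
    unfolding cox_len_def [symmetric] by blast
  then show ?thesis using that [of ws] by (simp add: reduced_def)
qed

lemma len_one [simp]: "len \<one> = 0"
  using len_wprod_le [of "[]"] by simp

lemma len_generator_le: "a \<in> A \<Longrightarrow> len a \<le> 1"
  using len_wprod_le [of "[a]"] by simp

lemma len_mult_le:
  assumes "x \<in> generate G A" "y \<in> generate G A"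
  shows "len (x \<otimes> y) \<le> len x + len y"
proof -
  obtain us vs where "reduced us" "wprod G us = x" "reduced vs" "wprod G vs = y"
    using assms by (metis reduced_word_exists)
  then show ?thesis
    using len_wprod_le [of "us @ vs"] by (auto simp: reduced_def wprod_append)
qed

lemma len_inv:
  assumes "w \<in> generate G A"
  shows "len (inv w) = len w"
proof -
  have le: "len (inv w) \<le> len w" if w: "w \<in> generate G A" for w
  proof -
    obtain ws where "reduced ws" "wprod G ws = w" using w by (rule reduced_word_exists)
    then show ?thesis
      using len_wprod_le [of "rev ws"] inv_wprod [of ws] by (simp add: reduced_def)
  qed
  show ?thesis
    using le [OF assms] le [of "inv w"] assms generate_m_inv_closed [OF gens_subset]
    by (simp add: generated_closed)
qed

lemma len_inv_mult_le_suffixes: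
  assumes "ws @ us \<in> lists A" "ws @ vs \<in> lists A"
  shows "len (inv (wprod G (ws @ us)) \<otimes> wprod G (ws @ vs)) \<le> length us + length vs"
proof -
  have "inv (wprod G (ws @ us)) \<otimes> wprod G (ws @ vs) = wprod G (rev us @ vs)"
    using assms by (simp add: wprod_append inv_mult_group m_assoc inv_wprod [of us, symmetric])
  then show ?thesis
    using assms len_wprod_le [of "rev us @ vs"] by simp
qed

lemma reduced_appendD:
  assumes "reduced (us @ vs)"
  shows "reduced vs"
proof -
  have "us \<in> lists A" "vs \<in> lists A" using assms by (auto simp: reduced_def)
  moreover from this have "length (us @ vs) \<le> len (wprod G us) + len (wprod G vs)"
    using assms len_mult_le [of "wprod G us" "wprod G vs"]
    by (simp add: reduced_def wprod_append wprod_in_generate)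
  ultimately show ?thesis
    using len_wprod_le [of us] len_wprod_le [of vs] by (simp add: reduced_def)
qed

lemma reduced_ConsD: "reduced (a # ws) \<Longrightarrow> reduced ws"
  using reduced_appendD [of "[a]" ws] by simp

lemma reduced_distinct_adj: "reduced ws \<Longrightarrow> distinct_adj ws"
proof (induction ws rule: induct_list012)
  case (3 a b ws)
  have "a \<noteq> b"
  proof
    assume "a = b"
    then have "wprod G (a # b # ws) = wprod G ws" "ws \<in> lists A"
      using "3.prems" by (auto simp: reduced_def)
    then show False using "3.prems" len_wprod_le [of ws] by (simp add: reduced_def)
  qed
  then show ?case using "3.IH" reduced_ConsD [OF "3.prems"] by simp
qed auto

lemma crosses_oddly_Cons:
  assumes "a \<in> A" "ws \<in> lists A" "t \<in> carrier G"
  shows "crosses_oddly G (a # ws) t \<longleftrightarrow> (t = a) \<noteq> crosses_oddly G ws (a \<otimes> t \<otimes> a)"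
  using count_list_map_conj [of a "walls G ws" t] walls_closed [of ws] assms
  by (auto simp: crosses_oddly_def)

lemma walls_alt_word:
  assumes "s \<in> A" "t \<in> A"
  shows "walls G (alt_word s t n) = map (\<lambda>i. (s \<otimes> t) [^] i \<otimes> s) [0..<n]"
  using assms
proof (induction n arbitrary: s t)
  case (Suc n)
  have "s \<otimes> ((t \<otimes> s) [^] i \<otimes> t) \<otimes> s = (s \<otimes> t) [^] Suc i \<otimes> s" for i :: nat
    using Suc.prems mult_nat_pow_shift [of s t i, symmetric] by (simp add: m_assoc [symmetric])
  then have "walls G (alt_word s t (Suc n)) =
      s # map (\<lambda>i. (s \<otimes> t) [^] Suc i \<otimes> s) [0..<n]"
    using Suc by simp
  also have "\<dots> = map (\<lambda>i. (s \<otimes> t) [^] i \<otimes> s) [0..<Suc n]"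
    using Suc.prems by (simp add: upt_conv_Cons map_Suc_upt [symmetric] o_def del: upt_Suc)
  finally show ?case .
qed simp

lemma not_crosses_oddly_relator:
  assumes "s \<in> A" "t \<in> A"
  shows "\<not> crosses_oddly G (alt_word s t (2 * ord (s \<otimes> t))) r"
proof -
  define m where "m = ord (s \<otimes> t)"
  define f where "f = (\<lambda>i::nat. (s \<otimes> t) [^] i \<otimes> s)"
  have "f (i + m) = f i" for i
    using assms by (simp add: f_def m_def nat_pow_mult [symmetric])
  then have "map f [m..<m + m] = map f [0..<m]"
    by (simp add: map_add_upt [symmetric, of m m] o_def add.commute)
  moreover have "[0..<2 * m] = [0..<m] @ [m..<m + m]"
    by (simp add: mult_2 upt_add_eq_append [symmetric])
  ultimately have "map f [0..<2 * m] = map f [0..<m] @ map f [0..<m]"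
    by simp
  then show ?thesis
    using assms by (simp add: crosses_oddly_def walls_alt_word f_def m_def)
qed

lemma deletion:
  assumes "ws \<in> lists A" "t \<in> set (walls G ws)"
  obtains us where "us \<in> lists A" "length us < length ws" "wprod G us = t \<otimes> wprod G ws"
  using assms
proof (induction ws arbitrary: t thesis)
  case (Cons a ws)
  then have a: "a \<in> A" and ws: "ws \<in> lists A" by auto
  consider "t = a" | r where "r \<in> set (walls G ws)" "t = a \<otimes> r \<otimes> a"
    using Cons.prems(2) a by auto
  then show ?case
  proof cases
    case 1
    then show ?thesis using Cons.prems(1) [of ws] a ws by simp
  next
    case 2
    then obtain us where us: "us \<in> lists A" "length us < length ws" "wprod G us = r \<otimes> wprod G ws"
      using Cons.IH ws by blast
    have "r \<in> carrier G" using 2 walls_closed [of ws] ws by (auto simp: in_lists_conv_set)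
    then have "wprod G (a # us) = t \<otimes> wprod G (a # ws)" using us 2 a ws by (simp add: m_assoc)
    then show ?thesis using Cons.prems(1) [of "a # us"] us a by simp
  qed
qed simp

end

section \<open>The inversion cocycle of a Coxeter system\<close>

locale coxeter =
  fixes G :: "('a, 'b) monoid_scheme" (structure) and S :: "'a set"
  assumes coxeter_system: "coxeter_system G S"

sublocale coxeter \<subseteq> involutive_generators G S
proof -
  interpret group G using coxeter_system by (simp add: coxeter_system_def)
  show "involutive_generators G S"
    by unfold_locales (use coxeter_system in \<open>auto simp: coxeter_system_def\<close>)
qed

context coxeter
begin

abbreviation T :: "'a set" where
  "T \<equiv> reflections G S"

abbreviation N :: "'a \<Rightarrow> 'a set" where
  "N \<equiv> left_inversions G S"

lemma generate_S [simp]: "generate G S = carrier G"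
  using coxeter_system by (simp add: coxeter_system_def)

lemmas word_exists_S = word_exists [unfolded generate_S]
  and reduced_word_exists_S = reduced_word_exists [unfolded generate_S]
  and len_inv_S = len_inv [unfolded generate_S]

lemma cox_move_lists: "cox_move G S x y \<Longrightarrow> x \<in> lists S \<longleftrightarrow> y \<in> lists S"
  using alt_word_in_lists by (fastforce simp: cox_move_def)

lemma cox_move_even_length: "cox_move G S x y \<Longrightarrow> even (length x) \<longleftrightarrow> even (length y)"
  by (auto simp: cox_move_def)

lemma cox_move_crosses_oddly:
  assumes "cox_move G S x y" "x \<in> lists S" "r \<in> carrier G"
  shows "crosses_oddly G x r \<longleftrightarrow> crosses_oddly G y r"
proof -
  obtain u v s t where st: "s \<in> S" "t \<in> S"
      and x: "x = u @ alt_word s t (2 * ord (s \<otimes> t)) @ v" and y: "y = u @ v"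
    using assms(1) unfolding cox_move_def by blast
  have uv: "u \<in> lists S" "v \<in> lists S" using assms(2) x by auto
  have "wprod G (alt_word s t (2 * ord (s \<otimes> t))) = \<one>"
    using st by (simp add: wprod_alt_word_double)
  then show ?thesis
    using st uv assms(3) not_crosses_oddly_relator [OF st]
    by (simp add: x y crosses_oddly_append alt_word_in_lists)
qed

lemma trivial_word_invariant:
  assumes "\<And>x y. cox_move G S x y \<Longrightarrow> x \<in> lists S \<Longrightarrow> f x = f y"
    and "ws \<in> lists S" "wprod G ws = \<one>"
  shows "f ws = f []"
proof -
  have "equivclp (cox_move G S) ws []"
    using coxeter_system assms(2,3) by (simp add: coxeter_system_def)
  then have "ws \<in> lists S \<longrightarrow> f ws = f []"
  proof (induction rule: converse_equivclp_induct)
    case (step y z)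
    then show ?case using assms(1) cox_move_lists by metis
  qed simp
  then show ?thesis using assms(2) by simp
qed

lemma even_length_trivial_word: "ws \<in> lists S \<Longrightarrow> wprod G ws = \<one> \<Longrightarrow> even (length ws)"
  using trivial_word_invariant [of "\<lambda>ws. even (length ws)"] cox_move_even_length by simp

lemma not_crosses_oddly_trivial_word:
  "ws \<in> lists S \<Longrightarrow> wprod G ws = \<one> \<Longrightarrow> t \<in> carrier G \<Longrightarrow> \<not> crosses_oddly G ws t"
  using trivial_word_invariant [of "\<lambda>ws. crosses_oddly G ws t"] cox_move_crosses_oddly by simp

lemma even_len_wprod:
  assumes "ws \<in> lists S"
  shows "even (len (wprod G ws)) \<longleftrightarrow> even (length ws)"
proof -
  obtain vs where vs: "reduced vs" "wprod G vs = wprod G ws"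
    using reduced_word_exists_S [of "wprod G ws"] assms by auto
  then have "even (length (ws @ rev vs))"
    using assms by (intro even_length_trivial_word wprod_append_rev_eq_one) (auto simp: reduced_def)
  then show ?thesis using vs by (auto simp: reduced_def)
qed

lemma even_len_mult:
  assumes "x \<in> carrier G" "y \<in> carrier G"
  shows "even (len (x \<otimes> y)) \<longleftrightarrow> (even (len x) \<longleftrightarrow> even (len y))"
proof -
  obtain us vs where "us \<in> lists S" "wprod G us = x" "vs \<in> lists S" "wprod G vs = y"
    using assms by (metis word_exists_S)
  then show ?thesis
    using even_len_wprod [of "us @ vs"] even_len_wprod [of us] even_len_wprod [of vs]
    by (auto simp: wprod_append)
qed

lemma reflectionE:
  assumes "t \<in> T"
  obtains p s where "p \<in> carrier G" "s \<in> S" "t = p \<otimes> s \<otimes> inv p"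
  using assms unfolding reflections_def by blast

lemma conj_S_reflection: "p \<in> carrier G \<Longrightarrow> s \<in> S \<Longrightarrow> p \<otimes> s \<otimes> inv p \<in> T"
  unfolding reflections_def by blast

lemma S_reflection: "s \<in> S \<Longrightarrow> s \<in> T"
  using conj_S_reflection [of \<one> s] by simp

sublocale reflection: involutive_generators G T
  by unfold_locales (auto elim!: reflectionE simp: m_assoc)

lemma conj_reflection:
  assumes "t \<in> T" "x \<in> carrier G"
  shows "x \<otimes> t \<otimes> inv x \<in> T"
proof -
  obtain p s where "p \<in> carrier G" "s \<in> S" "t = p \<otimes> s \<otimes> inv p"
    using assms(1) by (rule reflectionE)
  then show ?thesis
    using conj_S_reflection [of "x \<otimes> p" s] assms(2) by (simp add: inv_mult_group m_assoc)
qed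

lemma inv_conj_reflection: "t \<in> T \<Longrightarrow> x \<in> carrier G \<Longrightarrow> inv x \<otimes> t \<otimes> x \<in> T"
  using conj_reflection [of t "inv x"] by simp

lemma odd_len_reflection: "t \<in> T \<Longrightarrow> odd (len t)"
proof (elim reflectionE)
  fix p s assume "p \<in> carrier G" "s \<in> S" "t = p \<otimes> s \<otimes> inv p"
  then show "odd (len t)"
    using even_len_wprod [of "[s]"] by (simp add: even_len_mult len_inv_S)
qed

lemma one_not_reflection: "\<one> \<notin> T"
  using odd_len_reflection [of \<one>] by auto

lemma even_len_wprod_reflections:
  "ws \<in> lists T \<Longrightarrow> even (len (wprod G ws)) \<longleftrightarrow> even (length ws)"
  by (induction ws rule: lists.induct) (simp_all add: even_len_mult odd_len_reflection)

lemma crosses_oddly_cong: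
  assumes "us \<in> lists S" "vs \<in> lists S" "wprod G us = wprod G vs" "t \<in> carrier G"
  shows "crosses_oddly G us t \<longleftrightarrow> crosses_oddly G vs t"
proof -
  have "\<not> crosses_oddly G (ws @ rev vs) t" if "ws \<in> lists S" "wprod G ws = wprod G vs" for ws
    using that assms by (intro not_crosses_oddly_trivial_word wprod_append_rev_eq_one) auto
  from this [of us] this [of vs] show ?thesis
    using assms by (simp add: crosses_oddly_append)
qed

lemma reflection_crosses_own_wall:
  assumes "t \<in> T"
  obtains ts where "ts \<in> lists S" "wprod G ts = t" "crosses_oddly G ts t"
proof -
  obtain p s where p: "p \<in> carrier G" "s \<in> S" "t = p \<otimes> s \<otimes> inv p"
    using assms by (rule reflectionE)
  obtain ps where ps: "ps \<in> lists S" "wprod G ps = p"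
    using p(1) by (rule word_exists_S)
  have s: "inv p \<otimes> t \<otimes> p = s" using p by (simp add: m_assoc)
  have "\<not> crosses_oddly G (ps @ rev ps) t"
    using ps assms by (intro not_crosses_oddly_trivial_word wprod_append_rev_eq_one) auto
  then have "crosses_oddly G ps t \<longleftrightarrow> crosses_oddly G (rev ps) s"
    using ps assms s by (simp add: crosses_oddly_append)
  then have "crosses_oddly G (ps @ s # rev ps) t"
    using ps assms p(2) s by (simp add: crosses_oddly_append crosses_oddly_Cons)
  moreover have "wprod G (ps @ s # rev ps) = t"
    using ps p by (simp add: wprod_append inv_wprod [symmetric] m_assoc)
  ultimately show ?thesis using that [of "ps @ s # rev ps"] ps p(2) by simp
qed

lemma len_reflection_mult_less:
  assumes ws: "ws \<in> lists S" and t: "t \<in> T" "crosses_oddly G ws t"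
  shows "len (t \<otimes> wprod G ws) < len (wprod G ws)"
proof -
  obtain vs where vs: "reduced vs" "wprod G vs = wprod G ws"
    using reduced_word_exists_S [of "wprod G ws"] ws by auto
  then have "crosses_oddly G vs t"
    using crosses_oddly_cong [of vs ws t] ws t by (simp add: reduced_def)
  then have "t \<in> set (walls G vs)" by (rule crosses_oddly_imp_wall)
  then obtain us where "us \<in> lists S" "length us < length vs" "wprod G us = t \<otimes> wprod G vs"
    using deletion [of vs t] vs(1) unfolding reduced_def by blast
  then show ?thesis using len_wprod_le [of us] vs by (simp add: reduced_def)
qed

lemma left_inversions_wprod_iff:
  assumes "ws \<in> lists S" "t \<in> T"
  shows "t \<in> N (wprod G ws) \<longleftrightarrow> crosses_oddly G ws t"
proof (cases "crosses_oddly G ws t")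
  case True
  then show ?thesis
    using len_reflection_mult_less assms by (simp add: left_inversions_def)
next
  case False
  obtain ts where ts: "ts \<in> lists S" "wprod G ts = t" "crosses_oddly G ts t"
    using assms(2) by (rule reflection_crosses_own_wall)
  then have "crosses_oddly G (ts @ ws) t"
    using False assms by (simp add: crosses_oddly_append m_assoc)
  then have "len (wprod G ws) < len (t \<otimes> wprod G ws)"
    using len_reflection_mult_less [of "ts @ ws" t] ts assms by (simp add: wprod_append)
  then show ?thesis using False by (simp add: left_inversions_def)
qed

lemma left_inversions_subset: "N w \<subseteq> T"
  by (auto simp: left_inversions_def)

lemma left_inversions_mult:
  assumes "x \<in> carrier G" "y \<in> carrier G" "t \<in> T"
  shows "t \<in> N (x \<otimes> y) \<longleftrightarrow> (t \<in> N x) \<noteq> (inv x \<otimes> t \<otimes> x \<in> N y)"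
proof -
  obtain us vs where "us \<in> lists S" "wprod G us = x" "vs \<in> lists S" "wprod G vs = y"
    using assms(1,2) by (metis word_exists_S)
  then show ?thesis
    using left_inversions_wprod_iff [of "us @ vs" t] left_inversions_wprod_iff [of us t]
      left_inversions_wprod_iff [of vs "inv x \<otimes> t \<otimes> x"] assms
    by (auto simp: wprod_append crosses_oddly_append inv_conj_reflection)
qed

lemma left_inversions_S: "s \<in> S \<Longrightarrow> N s = {s}"
  using left_inversions_wprod_iff [of "[s]"] left_inversions_subset [of s] S_reflection
  by (auto simp: crosses_oddly_Cons)

lemma left_inversions_mult_S:
  assumes "w \<in> carrier G" "s \<in> S"
  shows "N (w \<otimes> s) = sym_diff (N w) {w \<otimes> s \<otimes> inv w}"
proof -
  have "t \<in> N (w \<otimes> s) \<longleftrightarrow> (t \<in> N w) \<noteq> (w \<otimes> s \<otimes> inv w = t)" if "t \<in> T" for t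
    using left_inversions_mult [of w s t] conj_eq_iff [of w s t] assms that
    by (auto simp: left_inversions_S)
  then show ?thesis
    using left_inversions_subset [of w] left_inversions_subset [of "w \<otimes> s"]
      conj_S_reflection [OF assms] by blast
qed

lemma reflection_in_own_left_inversions: "t \<in> T \<Longrightarrow> t \<in> N t"
  using reflection_crosses_own_wall left_inversions_wprod_iff by metis

lemma left_inversions_mult_self: "t \<in> T \<Longrightarrow> w \<in> carrier G \<Longrightarrow> t \<in> N (t \<otimes> w) \<longleftrightarrow> t \<notin> N w"
  using left_inversions_mult [of t w t] by (simp add: reflection_in_own_left_inversions m_assoc)

lemma not_left_inversion_iff:
  "t \<in> T \<Longrightarrow> w \<in> carrier G \<Longrightarrow> t \<notin> N w \<longleftrightarrow> len w < len (t \<otimes> w)"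
  using left_inversions_mult_self [of t w] by (auto simp: left_inversions_def)

end

section \<open>Cosets and canonical generators of reflection subgroups\<close>

context coxeter
begin

definition minimal_reps :: "'a set \<Rightarrow> 'a set" where
  "minimal_reps H = {y \<in> carrier G. N y \<inter> H = {}}"

lemma minimal_reps_closed: "y \<in> minimal_reps H \<Longrightarrow> y \<in> carrier G"
  by (simp add: minimal_reps_def)

lemma minimal_repsD: "y \<in> minimal_reps H \<Longrightarrow> c \<in> H \<Longrightarrow> c \<notin> N y"
  by (auto simp: minimal_reps_def)

lemma one_in_minimal_reps: "\<one> \<in> minimal_reps H"
  by (simp add: minimal_reps_def left_inversions_def)

lemma canonical_gens_subset: "canonical_gens G S H \<subseteq> T \<inter> H"
  by (auto simp: canonical_gens_def)

lemma canonical_gens_carrier: "canonical_gens G S H \<subseteq> carrier G"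
  by (auto simp: canonical_gens_def)

lemma left_inversions_coset:
  assumes "subgroup H G" and h: "h \<in> H" and y: "y \<in> minimal_reps H"
  shows "N (h \<otimes> y) \<inter> H = N h \<inter> H"
proof -
  interpret H: subgroup H G by fact
  have "c \<in> N (h \<otimes> y) \<longleftrightarrow> c \<in> N h" if c: "c \<in> T" "c \<in> H" for c
  proof -
    have "inv h \<otimes> c \<otimes> h \<in> H" using h c by simp
    then show ?thesis
      using left_inversions_mult [of h y c] minimal_repsD [OF y] minimal_reps_closed [OF y] h c
      by simp
  qed
  then show ?thesis using left_inversions_subset by blast
qed

lemma minimal_rep_wall_canonical:
  assumes H: "subgroup H G" and y: "y \<in> minimal_reps H" and s: "s \<in> S"
    and p: "y \<otimes> s \<otimes> inv y \<in> H"
  shows "y \<otimes> s \<otimes> inv y \<in> canonical_gens G S H"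
proof -
  let ?p = "y \<otimes> s \<otimes> inv y"
  have yc: "y \<in> carrier G" using y by (rule minimal_reps_closed)
  have "N ?p \<inter> H = N (?p \<otimes> y) \<inter> H"
    using left_inversions_coset [OF H p y] by simp
  also have "?p \<otimes> y = y \<otimes> s" using yc s by (simp add: m_assoc)
  also have "N (y \<otimes> s) \<inter> H = {?p}"
    unfolding left_inversions_mult_S [OF yc s]
    using p minimal_repsD [OF y] by blast
  finally show ?thesis
    using conj_S_reflection [OF yc s] by (simp add: canonical_gens_def)
qed

lemma minimal_reps_mult_S:
  assumes "y \<in> minimal_reps H" "s \<in> S" "y \<otimes> s \<otimes> inv y \<notin> H"
  shows "y \<otimes> s \<in> minimal_reps H"
  using assms by (simp add: minimal_reps_def left_inversions_mult_S disjoint_iff)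

lemma coset_factorization:
  assumes H: "subgroup H G" and w: "w \<in> carrier G"
  obtains h y where "h \<in> generate G (canonical_gens G S H)" "y \<in> minimal_reps H" "w = h \<otimes> y"
proof -
  let ?C = "canonical_gens G S H"
  have "\<exists>h \<in> generate G ?C. \<exists>y \<in> minimal_reps H. wprod G ws = h \<otimes> y" if "ws \<in> lists S" for ws
    using that
  proof (induction ws rule: rev_induct)
    case Nil
    show ?case by (intro bexI [of _ \<one>]) (simp_all add: generate.one one_in_minimal_reps)
  next
    case (snoc s ws)
    then have s: "s \<in> S" and ws: "ws \<in> lists S" by auto
    then obtain h y where h: "h \<in> generate G ?C" and y: "y \<in> minimal_reps H"
      and eq: "wprod G ws = h \<otimes> y"
      using snoc.IH by blast
    have hc: "h \<in> carrier G" using h by (rule generate_in_carrier [OF canonical_gens_carrier])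
    have yc: "y \<in> carrier G" using y by (rule minimal_reps_closed)
    let ?p = "y \<otimes> s \<otimes> inv y"
    have word: "wprod G (ws @ [s]) = h \<otimes> (y \<otimes> s)" "h \<otimes> (y \<otimes> s) = h \<otimes> ?p \<otimes> y"
      using s ws yc hc eq by (simp_all add: wprod_append m_assoc)
    show ?case
    proof (cases "?p \<in> H")
      case True
      then have "h \<otimes> ?p \<in> generate G ?C"
        using h minimal_rep_wall_canonical [OF H y s] by (blast intro: generate.eng generate.incl)
      then show ?thesis using y word by metis
    next
      case False
      then show ?thesis using h word(1) minimal_reps_mult_S [OF y s] by blast
    qed
  qed
  then show ?thesis using that w by (metis word_exists_S)
qed

lemma reflection_in_generate_canonical_gens:
  assumes H: "subgroup H G" and t: "t \<in> T" "t \<in> H"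
  shows "t \<in> generate G (canonical_gens G S H)"
proof -
  let ?C = "canonical_gens G S H"
  have C: "subgroup (generate G ?C) G"
    by (rule generate_is_subgroup [OF canonical_gens_carrier])
  have C_H: "generate G ?C \<subseteq> H"
    using canonical_gens_subset [of H] H by (intro generate_subgroup_incl) auto
  obtain p s where p: "p \<in> carrier G" "s \<in> S" "t = p \<otimes> s \<otimes> inv p"
    using t(1) by (rule reflectionE)
  obtain h y where h: "h \<in> generate G ?C" and y: "y \<in> minimal_reps H" and hy: "p = h \<otimes> y"
    using coset_factorization [OF H p(1)] .
  have hc: "h \<in> carrier G" using C h by (rule subgroup.mem_carrier)
  have yc: "y \<in> carrier G" using y by (rule minimal_reps_closed)
  let ?c = "y \<otimes> s \<otimes> inv y"
  have t_eq: "t = h \<otimes> ?c \<otimes> inv h"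
    using p yc hc hy by (simp add: inv_mult_group m_assoc)
  then have "?c = inv h \<otimes> t \<otimes> h"
    by (intro iffD1 [OF conj_eq_iff]) (use t_eq p(2) yc hc t(1) in simp_all)
  then have "?c \<in> H" using H C_H h t by (auto simp: subgroup.m_closed subgroup.m_inv_closed)
  then have "?c \<in> generate G ?C"
    using minimal_rep_wall_canonical [OF H y p(2)] by (simp add: generate.incl)
  then show ?thesis
    unfolding t_eq using C h by (simp add: subgroup.m_closed subgroup.m_inv_closed)
qed

lemma generate_canonical_gens:
  assumes "R \<subseteq> T"
  shows "generate G (canonical_gens G S (generate G R)) = generate G R"
proof (rule subset_antisym)
  have H: "subgroup (generate G R) G" using assms by (intro generate_is_subgroup) auto
  then show "generate G (canonical_gens G S (generate G R)) \<subseteq> generate G R"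
    using canonical_gens_subset [of "generate G R"] by (intro generate_subgroup_incl) auto
  show "generate G R \<subseteq> generate G (canonical_gens G S (generate G R))"
    using reflection_in_generate_canonical_gens [OF H] assms
      generate_is_subgroup [OF canonical_gens_carrier]
    by (intro generate_subgroup_incl) (auto intro: generate.incl)
qed

lemma left_inversions_subset_walls:
  assumes H: "subgroup H G" and "ws \<in> lists (canonical_gens G S H)"
  shows "N (wprod G ws) \<inter> H \<subseteq> set (walls G ws)"
  using assms(2)
proof (induction ws)
  case Nil
  then show ?case by (simp add: left_inversions_def)
next
  case (Cons a ws)
  then have a: "a \<in> T" "a \<in> H" "N a \<inter> H = {a}" by (auto simp: canonical_gens_def)
  have ws: "ws \<in> lists (carrier G)" using Cons canonical_gens_carrier by auto
  show ?case
  proof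
    fix c assume "c \<in> N (wprod G (a # ws)) \<inter> H"
    then have c: "c \<in> T" "c \<in> H" "c \<in> N (a \<otimes> wprod G ws)"
      using left_inversions_subset by auto
    then consider "c = a" | "a \<otimes> c \<otimes> a \<in> N (wprod G ws)"
      using left_inversions_mult [of a "wprod G ws" c] a ws by auto
    then show "c \<in> set (walls G (a # ws))"
    proof cases
      case 2
      moreover have "a \<otimes> c \<otimes> a \<in> H" using H a c by (simp add: subgroup.m_closed)
      ultimately have "a \<otimes> c \<otimes> a \<in> set (walls G ws)" using Cons by auto
      moreover have "c = a \<otimes> (a \<otimes> c \<otimes> a) \<otimes> inv a" using a c by (simp add: m_assoc)
      ultimately show ?thesis by auto
    qed simp
  qed
qed

text \<open>A reflection is one of its own walls, but the walls of the word \<open>abc\<close> are \<open>a\<close>, \<open>aba\<close> and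
  \<open>abcba\<close>.\<close>

lemma three_canonical_gens_mult_not_reflection:
  assumes H: "subgroup H G" and abc: "{a, b, c} \<subseteq> canonical_gens G S H"
    and distinct: "a \<noteq> b" "b \<noteq> c" "a \<noteq> c"
  shows "a \<otimes> b \<otimes> c \<notin> T"
proof
  assume "a \<otimes> b \<otimes> c \<in> T"
  have T: "a \<in> T" "b \<in> T" "c \<in> T" and "a \<in> H" "b \<in> H" "c \<in> H"
    using abc canonical_gens_subset [of H] by auto
  then have "a \<otimes> b \<otimes> c \<in> N (a \<otimes> b \<otimes> c) \<inter> H"
    using reflection_in_own_left_inversions \<open>a \<otimes> b \<otimes> c \<in> T\<close> H by (simp add: subgroup.m_closed)
  then have "a \<otimes> b \<otimes> c \<in> set (walls G [a, b, c])"
    using left_inversions_subset_walls [OF H, of "[a, b, c]"] abc T by (auto simp: m_assoc)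
  then consider "a \<otimes> (b \<otimes> c) = a" | "a \<otimes> (b \<otimes> c) = a \<otimes> (b \<otimes> a)"
    | "a \<otimes> (b \<otimes> c) = a \<otimes> (b \<otimes> (c \<otimes> (b \<otimes> a)))"
    using T by (auto simp: m_assoc)
  then show False
    by cases (use T distinct in \<open>simp_all add: reflection.gens_mult_eq_one_iff\<close>)
qed

end

section \<open>Left orders\<close>

context coxeter
begin

lemma bruhat_lt_len:
  assumes "bruhat_lt G S u v"
  shows "len u < len v"
proof -
  have "u = v \<or> len u < len v" if "(bruhat_step G S)\<^sup>*\<^sup>* u v"
    using that by (induction rule: rtranclp_induct) (auto simp: bruhat_step_def)
  then show ?thesis using assms by (auto simp: bruhat_lt_def bruhat_le_def)
qed

lemma bruhat_lt_reflection_mult: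
  assumes "u \<in> carrier G" "t \<in> T" "t \<notin> N u"
  shows "bruhat_lt G S u (t \<otimes> u)"
proof -
  have "len u < len (t \<otimes> u)" using assms by (simp add: not_left_inversion_iff)
  then have "bruhat_step G S u (t \<otimes> u)" using assms by (auto simp: bruhat_step_def)
  then show ?thesis
    using assms \<open>len u < len (t \<otimes> u)\<close> by (auto simp: bruhat_lt_def bruhat_le_def)
qed

lemma LX_step_iff:
  assumes "R \<subseteq> T"
  shows "LX_step G S R u v \<longleftrightarrow> u \<in> carrier G \<and> (\<exists>t \<in> R. v = t \<otimes> u \<and> t \<notin> N u)"
proof
  assume "LX_step G S R u v"
  then obtain t where t: "t \<in> R" "v = t \<otimes> u" "bruhat_lt G S u v"
    by (auto simp: LX_step_def)
  then have "u \<in> carrier G" "t \<notin> N u"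
    using bruhat_lt_len [of u v] by (auto simp: bruhat_lt_def bruhat_le_def left_inversions_def)
  then show "u \<in> carrier G \<and> (\<exists>t \<in> R. v = t \<otimes> u \<and> t \<notin> N u)" using t by blast
qed (use assms bruhat_lt_reflection_mult in \<open>auto simp: LX_step_def\<close>)

lemma le_LX_iff_rtranclp:
  assumes "R \<subseteq> T"
  shows "le_LX G S R u v \<longleftrightarrow> (LX_step G S R)\<^sup>*\<^sup>* u v"
proof
  assume "(LX_step G S R)\<^sup>*\<^sup>* u v"
  then show "le_LX G S R u v"
  proof (induction rule: rtranclp_induct)
    case (step y z)
    then have "len y < len z" by (auto simp: LX_step_def intro: bruhat_lt_len)
    then show ?case using step by (auto simp: le_LX_def)
  qed (simp add: le_LX_def)
qed (auto simp: le_LX_def)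

lemma order_ideal_T_subset: "order_ideal_T G S R \<Longrightarrow> R \<subseteq> T"
  by (simp add: order_ideal_T_def)

lemma le_LX_refl [simp]: "le_LX G S R u u"
  by (simp add: le_LX_def)

lemma le_LX_trans: "le_LX G S R u v \<Longrightarrow> le_LX G S R v w \<Longrightarrow> le_LX G S R u w"
  by (auto simp: le_LX_def)

lemma le_LX_reflection_mult:
  "R \<subseteq> T \<Longrightarrow> t \<in> R \<Longrightarrow> u \<in> carrier G \<Longrightarrow> t \<notin> N u \<Longrightarrow> le_LX G S R u (t \<otimes> u)"
  using r_into_rtranclp [of "LX_step G S R" u "t \<otimes> u"]
  by (auto simp: le_LX_iff_rtranclp LX_step_iff)

lemma le_LX_coset:
  assumes R: "R \<subseteq> T" and "subgroup H G" and y: "y \<in> minimal_reps H"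
    and h: "h \<in> H" and le: "le_LX G S (R \<inter> H) h g"
  shows "le_LX G S R (h \<otimes> y) (g \<otimes> y)"
proof -
  interpret H: subgroup H G by fact
  have yc: "y \<in> carrier G" using y by (rule minimal_reps_closed)
  have RH: "R \<inter> H \<subseteq> T" using R by blast
  have "(LX_step G S (R \<inter> H))\<^sup>*\<^sup>* h g" using le le_LX_iff_rtranclp [OF RH] by simp
  then have "g \<in> H \<and> le_LX G S R (h \<otimes> y) (g \<otimes> y)"
  proof (induction rule: rtranclp_induct)
    case (step u v)
    then obtain c where c: "c \<in> R" "c \<in> H" "v = c \<otimes> u" "c \<notin> N u"
      using LX_step_iff [OF RH] by blast
    have "c \<notin> N (u \<otimes> y)"
      using left_inversions_coset [OF assms(2) _ y, of u] step.IH c by blast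
    then have "le_LX G S R (u \<otimes> y) (c \<otimes> (u \<otimes> y))"
      using le_LX_reflection_mult [OF R c(1)] step.IH yc by simp
    then have "le_LX G S R (u \<otimes> y) (v \<otimes> y)" using c step.IH yc by (simp add: m_assoc)
    then show ?case using step.IH c le_LX_trans by auto
  qed (use h in simp)
  then show ?thesis ..
qed

lemma refl_sq'_len_le:
  assumes "refl_sq' G S t t'"
  shows "t \<in> T \<and> len t \<le> len t'"
proof -
  have "len t \<le> len t'" if "(bruhat_arrow_on G S W')\<^sup>*\<^sup>* t t'" for W'
    using that
    by (induction rule: rtranclp_induct)
      (auto simp: bruhat_arrow_on_def bruhat_arrow_def dest: bruhat_lt_len)
  then show ?thesis using assms by (auto simp: refl_sq'_def)
qed

lemma refl_sq_len_le: "refl_sq G S t t' \<Longrightarrow> t \<in> T \<and> len t \<le> len t'"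
  unfolding refl_sq_def
  by (induction rule: tranclp_induct) (use refl_sq'_len_le in \<open>auto intro: le_trans\<close>)

lemma order_ideal_refl_T_k: "order_ideal_T G S (refl_T_k G S k)"
  unfolding order_ideal_T_def refl_T_k_def by (auto dest!: refl_sq_len_le)

end

section \<open>Relative length in reflection subgroups\<close>

locale canonical_generators = coxeter G S for G :: "('a, 'b) monoid_scheme" (structure) and S +
  fixes A :: "'a set"
  assumes canonical: "A \<subseteq> canonical_gens G S (generate G A)"
begin

abbreviation H :: "'a set" where
  "H \<equiv> generate G A"

lemma gens_subset_T: "A \<subseteq> T"
  using canonical canonical_gens_subset by blast

lemma gens_subset_H: "A \<subseteq> H"
  by (auto intro: generate.incl)

sublocale gens: involutive_generators G A
  by unfold_locales (use gens_subset_T in auto)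

sublocale H: subgroup H G
  by (rule gens.generated_subgroup)

lemma exchange:
  assumes "w \<in> H" and c: "c \<in> T" "c \<in> H"
  shows "c \<in> N w \<longleftrightarrow> gens.len (c \<otimes> w) < gens.len w"
proof -
  have shorter: "gens.len (c \<otimes> v) < gens.len v" if v: "v \<in> H" "c \<in> N v" for v
  proof -
    obtain ws where ws: "gens.reduced ws" "wprod G ws = v"
      using v(1) by (rule gens.reduced_word_exists)
    then have "ws \<in> lists (canonical_gens G S H)"
      using canonical by (auto simp: gens.reduced_def)
    then have "c \<in> set (walls G ws)"
      using left_inversions_subset_walls [OF gens.generated_subgroup] ws v c by blast
    then obtain us where "us \<in> lists A" "length us < length ws" "wprod G us = c \<otimes> wprod G ws"
      using gens.deletion [of ws c] ws(1) unfolding gens.reduced_def by blast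
    then show ?thesis using gens.len_wprod_le [of us] ws by (simp add: gens.reduced_def)
  qed
  show ?thesis
  proof (cases "c \<in> N w")
    case False
    then have "gens.len (c \<otimes> (c \<otimes> w)) < gens.len (c \<otimes> w)"
      using assms by (intro shorter) (simp_all add: left_inversions_mult_self)
    then show ?thesis using False assms by simp
  qed (use shorter assms in simp)
qed

lemma not_left_inversion_iff_gens_len:
  assumes "w \<in> H" "c \<in> T" "c \<in> H"
  shows "c \<notin> N w \<longleftrightarrow> gens.len w < gens.len (c \<otimes> w)"
  using exchange [of "c \<otimes> w" c] left_inversions_mult_self [of c w] assms by simp

lemma gens_len_mult:
  assumes a: "a \<in> A" and w: "w \<in> H" and "a \<notin> N w"
  shows "gens.len (a \<otimes> w) = Suc (gens.len w)"
proof -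
  have "a \<in> T" "a \<in> H" using a gens_subset_T by (auto intro: generate.incl)
  then show ?thesis
    using assms not_left_inversion_iff_gens_len [of w a] gens.len_mult_le [of a w]
      gens.len_generator_le [OF a]
    by simp
qed

lemma even_gens_len:
  assumes "w \<in> H"
  shows "even (gens.len w) \<longleftrightarrow> even (len w)"
proof -
  obtain ws where ws: "gens.reduced ws" "wprod G ws = w"
    using assms by (rule gens.reduced_word_exists)
  then have "ws \<in> lists T" using gens_subset_T by (auto simp: gens.reduced_def)
  then show ?thesis
    using even_len_wprod_reflections [of ws] ws by (auto simp: gens.reduced_def)
qed

lemma generator_left_inversion_exists:
  assumes "w \<in> H" "w \<noteq> \<one>"
  obtains a where "a \<in> A" "a \<in> N w"
proof -
  obtain ws where ws: "gens.reduced ws" "wprod G ws = w"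
    using assms(1) by (rule gens.reduced_word_exists)
  then obtain a us where us: "ws = a # us" using assms(2) by (cases ws) auto
  then have a: "a \<in> A" and red: "gens.reduced us"
    using ws gens.reduced_ConsD [of a us] by (auto simp: gens.reduced_def)
  then have "a \<otimes> w = wprod G us"
    unfolding ws(2) [symmetric] us using a red by (simp add: gens.reduced_def)
  then have "gens.len (a \<otimes> w) < gens.len w"
    using ws us red by (auto simp: gens.reduced_def)
  then have "a \<in> N w"
    using exchange [OF assms(1), of a] a gens_subset_T by (auto intro: generate.incl)
  then show ?thesis using that a by blast
qed

lemma eq_one_if_no_left_inversions:
  assumes "w \<in> H" "N w \<inter> A = {}"
  shows "w = \<one>"
proof (rule ccontr)
  assume "w \<noteq> \<one>"
  then obtain a where "a \<in> A" "a \<in> N w" using assms(1) generator_left_inversion_exists by blast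
  then show False using assms(2) by blast
qed

lemma canonical_gens_generate: "canonical_gens G S H = A"
proof
  show "canonical_gens G S H \<subseteq> A"
  proof
    fix t assume "t \<in> canonical_gens G S H"
    then have t: "t \<in> T" "t \<in> H" "N t \<inter> H = {t}" by (auto simp: canonical_gens_def)
    then have "t \<noteq> \<one>" using one_not_reflection by auto
    then obtain a where "a \<in> A" "a \<in> N t"
      using generator_left_inversion_exists [OF t(2)] by blast
    moreover from this have "a \<in> H" by (simp add: generate.incl)
    ultimately show "t \<in> A" using t(3) by auto
  qed
qed (rule canonical)

lemma minimal_rep_unique:
  assumes "y \<in> minimal_reps H" "h \<in> H" "h \<otimes> y \<in> minimal_reps H"
  shows "h = \<one>"
proof -
  have "N h \<inter> H = {}"
    using left_inversions_coset [OF gens.generated_subgroup assms(2,1)] assms(3)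
    by (simp add: minimal_reps_def)
  then have "N h \<inter> A = {}" using gens_subset_H by blast
  with assms(2) show ?thesis by (rule eq_one_if_no_left_inversions)
qed

lemma minimal_reps_iff: "y \<in> minimal_reps H \<longleftrightarrow> y \<in> carrier G \<and> N y \<inter> A = {}"
proof
  assume y: "y \<in> carrier G \<and> N y \<inter> A = {}"
  obtain h z where h: "h \<in> H" and z: "z \<in> minimal_reps H" and hz: "y = h \<otimes> z"
    using coset_factorization [OF gens.generated_subgroup, of y] y
    unfolding canonical_gens_generate by blast
  have "N y \<inter> H = N h \<inter> H"
    using left_inversions_coset [OF gens.generated_subgroup h z] hz by simp
  then have "N h \<inter> A = {}" using gens_subset_H y by blast
  with h have "h = \<one>" by (rule eq_one_if_no_left_inversions)
  then show "y \<in> minimal_reps H" using hz z minimal_reps_closed [OF z] by simp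
qed (auto simp: minimal_reps_def intro: generate.incl)

lemma reflection_eq_single_generator:
  assumes A: "A \<subseteq> {a}" and t: "t \<in> T" "t \<in> H"
  shows "t = a"
proof -
  have "t \<noteq> \<one>" using t one_not_reflection by auto
  then have a: "a \<in> A" "a \<in> N t"
    using generator_left_inversion_exists [OF t(2)] A by blast+
  then have aT: "a \<in> T" "a \<in> H" using gens_subset_T by (auto intro: generate.incl)
  then have "a \<notin> N (a \<otimes> t)" using left_inversions_mult_self [of a t] a(2) t by simp
  then have "a \<otimes> t = \<one>"
    using generator_left_inversion_exists [of "a \<otimes> t"] A aT(2) t(2) by blast
  then show ?thesis using a(1) t(1) by (simp add: gens.gens_mult_eq_one_iff)
qed

lemma reduced_suffix_le_LX:
  assumes R: "A \<subseteq> R" "R \<subseteq> T" and "gens.reduced (us @ vs)"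
  shows "le_LX G S (R \<inter> H) (wprod G vs) (wprod G (us @ vs))"
  using assms(3)
proof (induction us)
  case (Cons a us)
  let ?w = "wprod G (us @ vs)"
  have red: "gens.reduced (us @ vs)" using Cons.prems gens.reduced_ConsD by simp
  have a: "a \<in> A" "a \<in> T" "a \<in> H"
    using Cons.prems gens_subset_T by (auto simp: gens.reduced_def intro: generate.incl)
  have w: "?w \<in> H" using red by (simp add: gens.reduced_def gens.wprod_in_generate)
  have "a \<notin> N ?w"
    using not_left_inversion_iff_gens_len [OF w a(2,3)] Cons.prems red
    by (simp add: gens.reduced_def)
  then have "le_LX G S (R \<inter> H) ?w (a \<otimes> ?w)"
    using R a w by (intro le_LX_reflection_mult) auto
  then show ?case using Cons.IH [OF red] le_LX_trans by simp
qed simp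

end

section \<open>Dihedral reflection subgroups\<close>

context coxeter
begin

lemma odd_palindrome_reflection:
  assumes ws: "ws \<in> lists T" and "rev ws = ws" and "odd (length ws)"
  shows "wprod G ws \<in> T"
proof -
  obtain n where n: "length ws = 2 * n + 1" using assms(3) by (rule oddE)
  define us t where "us = take n ws" and "t = ws ! n"
  have "rev us = drop (Suc n) ws"
    using n by (simp add: us_def rev_take assms(2))
  then have eq: "ws = us @ [t] @ rev us"
    using id_take_nth_drop [of n ws] n by (simp add: us_def t_def)
  have us: "us \<in> lists T" and t: "t \<in> T"
    using ws unfolding eq by (auto simp: in_lists_conv_set)
  have "wprod G ws = wprod G us \<otimes> t \<otimes> inv (wprod G us)"
    unfolding eq using us t by (simp add: wprod_append reflection.inv_wprod m_assoc)
  then show ?thesis using conj_reflection us t by simp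
qed

lemma odd_len_generate_pair_reflection:
  assumes tr: "t \<in> T" "r \<in> T" and w: "w \<in> generate G {t, r}" "odd (len w)"
  shows "w \<in> T"
proof -
  interpret pair: involutive_generators G "{t, r}"
    by unfold_locales (use tr in auto)
  obtain ws where ws: "pair.reduced ws" "wprod G ws = w"
    using w(1) by (rule pair.reduced_word_exists)
  then have lists: "ws \<in> lists {t, r}" by (simp add: pair.reduced_def)
  then obtain x y where "ws = alt_word x y (length ws)"
    using distinct_adj_two_letters pair.reduced_distinct_adj [OF ws(1)] by metis
  moreover have "ws \<in> lists T" using lists tr by auto
  moreover from this have "odd (length ws)" using even_len_wprod_reflections ws(2) w(2) by auto
  ultimately show ?thesis
    using odd_palindrome_reflection [of ws] rev_alt_word [of x y "length ws"] ws(2) by simp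
qed

end

locale dihedral_subgroup = canonical_generators G S "{a, b}"
  for G :: "('a, 'b) monoid_scheme" (structure) and S a b +
  assumes gens_neq: "a \<noteq> b"

lemma (in coxeter) dihedral_subgroup_generated_by_pair:
  assumes t: "t \<in> T" and r: "r \<in> T" and neq: "t \<noteq> r"
  obtains a b where "dihedral_subgroup G S a b" "generate G {a, b} = generate G {t, r}"
proof -
  let ?C = "canonical_gens G S (generate G {t, r})"
  have gen: "generate G ?C = generate G {t, r}"
    using t r by (intro generate_canonical_gens) simp
  interpret C: canonical_generators G S ?C
    by unfold_locales (simp add: gen)
  have tr: "t \<in> C.H" "r \<in> C.H" unfolding gen by (auto intro: generate.incl)
  have "\<not> ?C \<subseteq> {c}" for c
    using C.reflection_eq_single_generator [OF _ t tr(1)]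
      C.reflection_eq_single_generator [OF _ r tr(2)] neq by metis
  then obtain a b where ab: "a \<in> ?C" "b \<in> ?C" "a \<noteq> b" by blast
  have "c \<in> {a, b}" if c: "c \<in> ?C" for c
  proof (rule ccontr)
    assume "c \<notin> {a, b}"
    have "a \<otimes> b \<otimes> c \<in> C.H" "odd (len (a \<otimes> b \<otimes> c))"
      using ab c C.gens_subset_T
      by (auto simp: even_len_mult odd_len_reflection subset_iff generate.incl)
    then have "a \<otimes> b \<otimes> c \<in> T"
      using odd_len_generate_pair_reflection [OF t r] gen by simp
    then show False
      using three_canonical_gens_mult_not_reflection [OF C.gens.generated_subgroup, of a b c]
        C.canonical ab c \<open>c \<notin> {a, b}\<close> by auto
  qed
  then have "?C = {a, b}" using ab by auto
  then show ?thesis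
    using that ab(3) gen C.canonical_generators_axioms
    by (metis dihedral_subgroup.intro dihedral_subgroup_axioms.intro)
qed

context dihedral_subgroup
begin

lemma dihedral_refl_subgroup_H: "dihedral_refl_subgroup G S H"
proof -
  have "reflection_subgroup G S H" using gens_subset_T unfolding reflection_subgroup_def by blast
  then show ?thesis
    using gens_neq by (simp add: dihedral_refl_subgroup_def canonical_gens_generate)
qed

lemma alternating_form:
  assumes "w \<in> H"
  obtains x y where "{x, y} = {a, b}" "w = wprod G (alt_word x y (gens.len w))"
proof -
  obtain ws where ws: "gens.reduced ws" "wprod G ws = w"
    using assms by (rule gens.reduced_word_exists)
  then have "ws \<in> lists {a, b}" "length ws = gens.len w" by (auto simp: gens.reduced_def)
  then show ?thesis
    using that ws(2) distinct_adj_two_letters [OF gens.reduced_distinct_adj [OF ws(1)]] by metis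
qed

lemma alternating_cases:
  assumes "{x, y} = {a, b}" "w \<in> H"
  obtains "w = wprod G (alt_word x y (gens.len w))" | "w = wprod G (alt_word y x (gens.len w))"
  using alternating_form [OF assms(2)] assms(1) by (metis doubleton_eq_iff)

lemma alternating_word_in_lists: "{x, y} = {a, b} \<Longrightarrow> alt_word x y n \<in> lists {a, b}"
  using alt_word_in_lists [of x "{a, b}" y n] by auto

lemma odd_gens_len_iff_reflection: "w \<in> H \<Longrightarrow> odd (gens.len w) \<longleftrightarrow> w \<in> T"
  using odd_len_generate_pair_reflection [of a b w] odd_len_reflection [of w] even_gens_len [of w]
    gens_subset_T by auto

lemma quotient_reflection:
  assumes "u \<in> H" "v \<in> H" "odd (gens.len u + gens.len v)"
  shows "v \<otimes> inv u \<in> T"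
proof -
  have "odd (len (v \<otimes> inv u))"
    using assms by (simp add: even_gens_len even_len_mult len_inv_S)
  then show ?thesis
    using assms odd_gens_len_iff_reflection [of "v \<otimes> inv u"] even_gens_len by simp
qed

lemma quotient_not_left_inversion:
  assumes "u \<in> H" "v \<in> H" "odd (gens.len u + gens.len v)" "gens.len u < gens.len v"
  shows "v \<otimes> inv u \<notin> N u"
  using not_left_inversion_iff_gens_len [of u "v \<otimes> inv u"] quotient_reflection [OF assms(1-3)] assms
  by (simp add: m_assoc)

lemma bruhat_arrow_on_H:
  assumes "u \<in> H" "v \<in> H" "odd (gens.len u + gens.len v)" "gens.len u < gens.len v"
  shows "bruhat_arrow_on G S H u v"
proof -
  have "bruhat_lt G S u (v \<otimes> inv u \<otimes> u)"
    using assms quotient_reflection quotient_not_left_inversion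
    by (intro bruhat_lt_reflection_mult) simp_all
  moreover have "u \<otimes> inv v \<in> T"
    using quotient_reflection [of v u] assms by (simp add: add.commute)
  ultimately show ?thesis
    using assms by (simp add: bruhat_arrow_on_def bruhat_arrow_def m_assoc)
qed

lemma refl_sq_if_gens_len_less:
  assumes t: "t \<in> T" "t \<in> H" and c: "c \<in> T" "c \<in> H" and less: "gens.len c < gens.len t"
  shows "refl_sq G S c t"
proof -
  have "t \<noteq> \<one>" using t one_not_reflection by auto
  then obtain x where x: "x \<in> {a, b}" "x \<in> N t"
    using generator_left_inversion_exists [OF t(2)] by blast
  have xT: "x \<in> T" "x \<in> H" using x(1) gens_subset_T by (auto intro: generate.incl)
  have xt: "gens.len t = Suc (gens.len (x \<otimes> t))"
    using gens_len_mult [OF x(1), of "x \<otimes> t"] left_inversions_mult_self [of x t] x(2) xT t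
    by simp
  have odd: "odd (gens.len t)" "odd (gens.len c)"
    using t c by (simp_all add: odd_gens_len_iff_reflection)
  then have "gens.len c < gens.len (x \<otimes> t)"
    using less xt by (metis even_Suc less_SucE)
  then have "bruhat_arrow_on G S H c (x \<otimes> t)" "bruhat_arrow_on G S H (x \<otimes> t) t"
    using xt odd xT t c by (auto intro!: bruhat_arrow_on_H)
  then have "(bruhat_arrow_on G S H)\<^sup>*\<^sup>* c t" by auto
  then have "refl_sq' G S c t"
    using t c dihedral_refl_subgroup_H by (auto simp: refl_sq'_def)
  then show ?thesis by (simp add: refl_sq_def)
qed

lemma order_ideal_gens_len_less:
  assumes "order_ideal_T G S R" "t \<in> R" "t \<in> H" "c \<in> T" "c \<in> H" "gens.len c < gens.len t"
  shows "c \<in> R"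
  using refl_sq_if_gens_len_less [of t c] assms unfolding order_ideal_T_def by blast

lemma le_LX_if_gens_len_add_less:
  assumes R: "order_ideal_T G S R" and t: "t \<in> R" "t \<in> H" and u: "u \<in> H" and v: "v \<in> H"
    and "odd (gens.len u + gens.len v)" "gens.len u < gens.len v"
    and less: "gens.len u + gens.len v < gens.len t"
  shows "le_LX G S (R \<inter> H) u v"
proof -
  let ?c = "v \<otimes> inv u"
  have c: "?c \<in> T" "?c \<in> H" "?c \<notin> N u"
    using quotient_reflection quotient_not_left_inversion assms by simp_all
  have "gens.len ?c \<le> gens.len v + gens.len u"
    using gens.len_mult_le [OF v, of "inv u"] gens.len_inv [OF u] u by simp
  then have "?c \<in> R" using order_ideal_gens_len_less [OF R t c(1,2)] less by simp
  then have "le_LX G S (R \<inter> H) u (?c \<otimes> u)"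
    using order_ideal_T_subset [OF R] c u by (intro le_LX_reflection_mult) auto
  then show ?thesis using u v by (simp add: m_assoc)
qed

lemma gens_len_alternating_quotient:
  assumes "{x, y} = {a, b}"
  shows "gens.len (inv (wprod G (alt_word x y k)) \<otimes> wprod G (alt_word x y n))
    \<le> max k n - min k n"
proof -
  have split: "\<exists>vs. alt_word x y n = alt_word x y m @ vs \<and> length vs = n - m" if "m \<le> n" for m n
    using alt_word_add [of x y m "n - m"] that by auto
  let ?p = "alt_word x y (min k n)"
  obtain us vs where us: "alt_word x y k = ?p @ us" "length us = k - min k n"
    and vs: "alt_word x y n = ?p @ vs" "length vs = n - min k n"
    using split [of "min k n" k] split [of "min k n" n] by auto
  have "gens.len (inv (wprod G (?p @ us)) \<otimes> wprod G (?p @ vs)) \<le> length us + length vs"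
    using alternating_word_in_lists [OF assms, of k] alternating_word_in_lists [OF assms, of n]
    unfolding us(1) vs(1) by (rule gens.len_inv_mult_le_suffixes)
  also have "\<dots> = max k n - min k n" using us(2) vs(2) by (simp add: max_def min_def)
  finally show ?thesis by (simp only: us(1) vs(1))
qed

text \<open>If \<open>t\<close> begins with the same letter as \<open>q\<close>, then \<open>tq\<close> is too short unless \<open>t\<close> is long;
  otherwise \<open>t\<close> begins with the same letter as \<open>w\<close>, and \<open>tw\<close> is too short unless \<open>t\<close> is long.\<close>

lemma gens_len_opposite_alternating_less:
  assumes xy: "{x, y} = {a, b}" and q: "q = wprod G (alt_word x y m)"
    and w: "w = wprod G (alt_word y x p)" and t: "t \<in> T" "t \<in> H" and "p < m"
    and tq: "p < gens.len (t \<otimes> q)" and tw: "m < gens.len (t \<otimes> w)"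
  shows "m + p < gens.len t"
proof -
  have yx: "{y, x} = {a, b}" using xy by auto
  define k where "k = gens.len t"
  have "w \<in> H" "gens.len w \<le> p"
    using gens.wprod_in_generate gens.len_wprod_le [of "alt_word y x p"]
      alternating_word_in_lists [OF yx] by (simp_all add: w)
  then have "m < k + p"
    using gens.len_mult_le [OF t(2), of w] tw by (simp add: k_def)
  have inv_t: "inv t = t" using t(1) by simp
  from xy t(2) have "m + p < k"
  proof (rule alternating_cases)
    assume "t = wprod G (alt_word x y (gens.len t))"
    then have "gens.len (t \<otimes> q) \<le> max k m - min k m"
      using gens_len_alternating_quotient [OF xy, of k m] inv_t by (simp add: q k_def)
    then show ?thesis using tq \<open>m < k + p\<close> by (simp add: max_def min_def split: if_splits)
  next
    assume "t = wprod G (alt_word y x (gens.len t))"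
    then have "gens.len (t \<otimes> w) \<le> max k p - min k p"
      using gens_len_alternating_quotient [OF yx, of k p] inv_t by (simp add: w k_def)
    then show ?thesis using tw \<open>p < m\<close> by (simp add: max_def min_def split: if_splits)
  qed
  then show ?thesis by (simp add: k_def)
qed

lemma alternating_suffix_le_LX:
  assumes "{a, b} \<subseteq> R" "R \<subseteq> T" "gens.reduced (alt_word x y m)" "n \<le> m"
    and v: "v = (if even (m - n) then alt_word x y n else alt_word y x n)"
  shows "gens.reduced v"
    and "le_LX G S (R \<inter> H) (wprod G v) (wprod G (alt_word x y m))"
proof -
  have eq: "alt_word x y m = alt_word x y (m - n) @ v"
    using alt_word_add [of x y "m - n" n] \<open>n \<le> m\<close> v by simp
  show "gens.reduced v" using assms(3) unfolding eq by (rule gens.reduced_appendD)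
  show "le_LX G S (R \<inter> H) (wprod G v) (wprod G (alt_word x y m))"
    using reduced_suffix_le_LX [OF assms(1,2)] assms(3) unfolding eq .
qed

text \<open>If \<open>w\<close> is not a suffix of \<open>q\<close>, then it is joined to the suffix of \<open>q\<close> that is one letter
  longer than \<open>w\<close>.\<close>

lemma alternating_le_LX:
  assumes R: "order_ideal_T G S R" and t: "t \<in> R" "t \<in> H" and gens_R: "{a, b} \<subseteq> R"
    and w: "w \<in> H" and q: "q \<in> H"
    and less: "gens.len w < gens.len q" and even: "even (gens.len w + gens.len q)"
    and tq: "gens.len w < gens.len (t \<otimes> q)" and tw: "gens.len q < gens.len (t \<otimes> w)"
  shows "le_LX G S (R \<inter> H) w q"
proof -
  have RT: "R \<subseteq> T" using R by (rule order_ideal_T_subset)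
  then have tT: "t \<in> T" using t(1) by blast
  define p m where "p = gens.len w" and "m = gens.len q"
  obtain x y where xy: "{x, y} = {a, b}" and q_eq: "q = wprod G (alt_word x y m)"
    using alternating_form [OF q] unfolding m_def by blast
  have q_red: "gens.reduced (alt_word x y m)"
    using alternating_word_in_lists [OF xy] q_eq by (simp add: gens.reduced_def m_def)
  note suffix = alternating_suffix_le_LX [OF gens_R RT q_red]
  have pm: "p < m" "even (m - p)" using less even by (simp_all add: p_def m_def)
  consider (same) "w = wprod G (alt_word x y p)" | (opposite) "w = wprod G (alt_word y x p)"
    using alternating_cases [OF xy w] unfolding p_def by blast
  then show ?thesis
  proof cases
    case same
    then show ?thesis using suffix(2) [of p] pm q_eq by simp
  next
    case opposite
    define v where "v = wprod G (alt_word y x (Suc p))"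
    have "gens.reduced (alt_word y x (Suc p))" and vq: "le_LX G S (R \<inter> H) v q"
      using suffix [of "Suc p" "alt_word y x (Suc p)"] pm
      unfolding v_def q_eq by (simp_all del: alt_word_Suc)
    then have v: "v \<in> H" "gens.len v = Suc p"
      unfolding v_def gens.reduced_def by (simp_all add: gens.wprod_in_generate del: alt_word_Suc)
    have "m + p < gens.len t"
      using gens_len_opposite_alternating_less [OF xy q_eq opposite tT t(2) pm(1)] tq tw
      by (simp add: p_def m_def)
    then have "le_LX G S (R \<inter> H) w v"
      using v pm by (intro le_LX_if_gens_len_add_less [OF R t w]) (auto simp: p_def)
    then show ?thesis using vq by (rule le_LX_trans)
  qed
qed

text \<open>In Bruhat order, the last three hypotheses say that \<open>w < rw < trw < tw\<close>.\<close>

lemma nested_arrows_le_LX_dihedral: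
  assumes R: "order_ideal_T G S R" and t: "t \<in> R" "t \<in> H" and r: "r \<in> T" "r \<in> H"
    and w: "w \<in> H"
    and arrows: "r \<notin> N w" "t \<notin> N (r \<otimes> w)" "t \<otimes> r \<otimes> t \<notin> N (t \<otimes> (r \<otimes> w))"
  shows "le_LX G S (R \<inter> H) w (t \<otimes> (r \<otimes> w))"
proof -
  let ?q = "t \<otimes> (r \<otimes> w)"
  have tT: "t \<in> T" using order_ideal_T_subset [OF R] t(1) by blast
  have trtT: "t \<otimes> r \<otimes> t \<in> T" using conj_reflection [OF r(1), of t] tT by simp
  have trt: "t \<otimes> r \<otimes> t \<otimes> ?q = t \<otimes> w" using tT r w by (simp add: m_assoc)
  have tq: "t \<otimes> ?q = r \<otimes> w" using tT r w by simp
  have less: "gens.len w < gens.len (r \<otimes> w)" "gens.len (r \<otimes> w) < gens.len ?q"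
    "gens.len ?q < gens.len (t \<otimes> w)"
    using arrows tT trtT r t w not_left_inversion_iff_gens_len [of w r]
      not_left_inversion_iff_gens_len [of "r \<otimes> w" t]
      not_left_inversion_iff_gens_len [of ?q "t \<otimes> r \<otimes> t"] trt
    by simp_all
  then have "3 \<le> gens.len t" using gens.len_mult_le [OF t(2) w] by linarith
  then have "c \<in> R" if "c \<in> {a, b}" for c
    using order_ideal_gens_len_less [OF R t, of c] gens.len_generator_le [OF that] gens_subset_T
      generate.incl [OF that] that by auto
  then have gens_R: "{a, b} \<subseteq> R" by blast
  have even: "even (gens.len w + gens.len ?q)"
    using tT r t w by (simp add: even_gens_len even_len_mult odd_len_reflection)
  show ?thesis
    by (rule alternating_le_LX [OF R t gens_R w]) (use less tq even t r w in auto)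
qed

end

lemma (in coxeter) nested_arrows_le_LX:
  assumes R: "order_ideal_T G S R" and t: "t \<in> R" and r: "r \<in> T" and x: "x \<in> carrier G"
    and rx: "r \<notin> N x" and trx: "t \<notin> N (r \<otimes> x)"
    and tx: "t \<otimes> r \<otimes> t \<notin> N (t \<otimes> (r \<otimes> x))"
  shows "le_LX G S R x (t \<otimes> (r \<otimes> x))"
proof -
  have RT: "R \<subseteq> T" using R by (rule order_ideal_T_subset)
  then have tT: "t \<in> T" using t by blast
  have "t \<noteq> r" using left_inversions_mult_self [of r x] r x rx trx by auto
  then obtain a b where "dihedral_subgroup G S a b"
    and gen: "generate G {a, b} = generate G {t, r}"
    using dihedral_subgroup_generated_by_pair [OF tT r] by blast
  then interpret dihedral_subgroup G S a b by simp
  have tr: "t \<in> H" "r \<in> H" unfolding gen by (auto intro: generate.incl)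
  obtain h y where h: "h \<in> H" and y: "y \<in> minimal_reps H" and hy: "x = h \<otimes> y"
    using coset_factorization [OF gens.generated_subgroup x] unfolding canonical_gens_generate .
  have yc: "y \<in> carrier G" using y by (rule minimal_reps_closed)
  have coset: "c \<in> N (g \<otimes> y) \<longleftrightarrow> c \<in> N g" if "g \<in> H" "c \<in> H" for c g
    using left_inversions_coset [OF gens.generated_subgroup that(1) y] that(2) by blast
  have assoc: "r \<otimes> x = r \<otimes> h \<otimes> y" "t \<otimes> (r \<otimes> x) = t \<otimes> (r \<otimes> h) \<otimes> y"
    using hy h yc tr by (simp_all add: m_assoc)
  have "le_LX G S (R \<inter> H) h (t \<otimes> (r \<otimes> h))"
  proof (rule nested_arrows_le_LX_dihedral [OF R t tr(1) r tr(2) h])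
    show "r \<notin> N h" using coset [OF h tr(2)] rx hy by simp
    show "t \<notin> N (r \<otimes> h)" using coset [of "r \<otimes> h" t] trx h tr unfolding assoc(1) by simp
    show "t \<otimes> r \<otimes> t \<notin> N (t \<otimes> (r \<otimes> h))"
      using coset [of "t \<otimes> (r \<otimes> h)" "t \<otimes> r \<otimes> t"] tx h tr unfolding assoc(2) by simp
  qed
  then show ?thesis
    unfolding assoc(2) unfolding hy by (rule le_LX_coset [OF RT gens.generated_subgroup y h])
qed

section \<open>Descending along a simple generator\<close>

context coxeter
begin

definition descend :: "'a \<Rightarrow> 'a \<Rightarrow> 'a" where
  "descend s w = (if len (w \<otimes> s) < len w then w \<otimes> s else w)"

lemma descend_closed: "w \<in> carrier G \<Longrightarrow> s \<in> S \<Longrightarrow> descend s w \<in> carrier G"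
  by (simp add: descend_def)

lemma len_mult_S_neq: "w \<in> carrier G \<Longrightarrow> s \<in> S \<Longrightarrow> len (w \<otimes> s) \<noteq> len w"
  using even_len_mult [of w s] odd_len_reflection [OF S_reflection, of s] by auto

lemma descend_mult_S:
  assumes "w \<in> carrier G" "s \<in> S"
  shows "descend s (w \<otimes> s) = descend s w"
  using len_mult_S_neq [OF assms] assms by (auto simp: descend_def m_assoc)

lemma le_LX_descend_reflection_mult:
  assumes R: "order_ideal_T G S R" and t: "t \<in> R" and s: "s \<in> S" and x: "x \<in> carrier G"
    and up: "len x < len (x \<otimes> s)" and tx: "t \<notin> N x"
  shows "le_LX G S R x (descend s (t \<otimes> x))"
proof -
  have RT: "R \<subseteq> T" using R by (rule order_ideal_T_subset)
  then have tT: "t \<in> T" using t by blast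
  define r where "r = x \<otimes> s \<otimes> inv x"
  have r: "r \<in> T" "r \<otimes> x = x \<otimes> s"
    using s x conj_S_reflection by (simp_all add: r_def m_assoc)
  have txs: "t \<otimes> x \<otimes> s = t \<otimes> (r \<otimes> x)" using tT s x r by (simp add: m_assoc)
  show ?thesis
  proof (cases "len (t \<otimes> x \<otimes> s) < len (t \<otimes> x)")
    case False
    then show ?thesis using le_LX_reflection_mult [OF RT t x tx] by (simp add: descend_def)
  next
    case True
    have "le_LX G S R x (t \<otimes> (r \<otimes> x))"
    proof (cases "t = r")
      case False
      show ?thesis
      proof (rule nested_arrows_le_LX [OF R t r(1) x])
        show "r \<notin> N x" using up r x by (simp add: not_left_inversion_iff)
        show "t \<notin> N (r \<otimes> x)"
          unfolding r(2) left_inversions_mult_S [OF x s] r_def [symmetric] using tx False by simp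
        have "t \<otimes> r \<otimes> t \<otimes> (t \<otimes> (r \<otimes> x)) = t \<otimes> x" using tT r(1) x by (simp add: m_assoc)
        then show "t \<otimes> r \<otimes> t \<notin> N (t \<otimes> (r \<otimes> x))"
          using True txs by (simp add: left_inversions_def)
      qed
    qed (use r(1) x in simp)
    then show ?thesis using True txs by (simp add: descend_def)
  qed
qed

lemma descend_mono:
  assumes R: "order_ideal_T G S R" and s: "s \<in> S" and "le_LX G S R u v"
  shows "le_LX G S R (descend s u) (descend s v)"
proof -
  have RT: "R \<subseteq> T" using R by (rule order_ideal_T_subset)
  have step: "le_LX G S R (descend s w) (descend s (t \<otimes> w))"
    if w: "w \<in> carrier G" and t: "t \<in> R" and tw: "t \<notin> N w" for t w
  proof (cases "len (w \<otimes> s) < len w")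
    case True
    define x where "x = w \<otimes> s"
    have x: "x \<in> carrier G" and w_eq: "w = x \<otimes> s" using w s by (simp_all add: x_def m_assoc)
    have up: "len x < len (x \<otimes> s)" using True by (simp flip: x_def w_eq)
    then have "x \<otimes> s \<otimes> inv x \<notin> N x"
      using x s conj_S_reflection [OF x s] by (simp add: not_left_inversion_iff m_assoc)
    then have "t \<notin> N x" using tw left_inversions_mult_S [OF x s] by (auto simp: w_eq)
    then have "le_LX G S R x (descend s (t \<otimes> x))"
      by (rule le_LX_descend_reflection_mult [OF R t s x up])
    moreover have "descend s (t \<otimes> w) = descend s (t \<otimes> x)"
      using descend_mult_S [of "t \<otimes> x" s] RT t x s by (auto simp: w_eq m_assoc)
    ultimately show ?thesis using True by (simp add: descend_def x_def)
  next
    case False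
    then have "len w < len (w \<otimes> s)" using len_mult_S_neq [OF w s] by simp
    then show ?thesis
      using le_LX_descend_reflection_mult [OF R t s w _ tw] False by (simp add: descend_def)
  qed
  have "(LX_step G S R)\<^sup>*\<^sup>* u v" using assms(3) by (simp add: le_LX_iff_rtranclp [OF RT])
  then show ?thesis
    by (induction rule: rtranclp_induct)
      (auto simp: LX_step_iff [OF RT] intro: le_LX_trans step)
qed

lemma canonical_generators_subset_S: "J \<subseteq> S \<Longrightarrow> canonical_generators G S J"
  by unfold_locales
    (auto simp: canonical_gens_def left_inversions_S S_reflection generate.incl)

end

section \<open>Projections to minimal coset representatives\<close>

locale parabolic_subgroup = coxeter G S for G :: "('a, 'b) monoid_scheme" (structure) and S +
  fixes J :: "'a set"
  assumes J_subset: "J \<subseteq> S"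

sublocale parabolic_subgroup \<subseteq> canonical_generators G S J
  using J_subset by (rule canonical_generators_subset_S)

context parabolic_subgroup
begin

abbreviation coset_reps :: "'a set" ("W\<^sup>J") where
  "W\<^sup>J \<equiv> min_coset_reps G S J"

abbreviation projection :: "'a \<Rightarrow> 'a" ("P\<^sup>J") where
  "P\<^sup>J \<equiv> proj_J G S J"

lemma len_mult_minimal_rep:
  assumes h: "h \<in> H" and y: "y \<in> minimal_reps H"
  shows "len (h \<otimes> y) = gens.len h + len y"
proof -
  interpret S: canonical_generators G S S by (rule canonical_generators_subset_S) simp
  have yc: "y \<in> carrier G" using y by (rule minimal_reps_closed)
  have "len (wprod G ws \<otimes> y) = length ws + len y" if "gens.reduced ws" for ws
    using that
  proof (induction ws)
    case (Cons s ws)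
    let ?w = "wprod G ws"
    have red: "gens.reduced ws" using Cons.prems by (rule gens.reduced_ConsD)
    have s: "s \<in> S" "s \<in> T" "s \<in> H" and w: "?w \<in> H"
      using Cons.prems J_subset S_reflection gens.wprod_in_generate
      by (auto simp: gens.reduced_def intro: generate.incl)
    have "s \<notin> N ?w"
      using not_left_inversion_iff_gens_len [OF w s(2,3)] Cons.prems red
      by (simp add: gens.reduced_def)
    then have "s \<notin> N (?w \<otimes> y)"
      using left_inversions_coset [OF gens.generated_subgroup w y] s(3) by blast
    then have "len (s \<otimes> (?w \<otimes> y)) = Suc (len (?w \<otimes> y))"
      using S.gens_len_mult [OF s(1), of "?w \<otimes> y"] w yc by simp
    then show ?case using Cons.IH [OF red] s w yc by (simp add: m_assoc)
  qed (use yc in simp)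
  moreover obtain ws where "gens.reduced ws" "wprod G ws = h"
    using h by (rule gens.reduced_word_exists)
  ultimately show ?thesis by (auto simp: gens.reduced_def)
qed

lemma gens_len_eq_len: "h \<in> H \<Longrightarrow> gens.len h = len h"
  using len_mult_minimal_rep [OF _ one_in_minimal_reps] by simp

lemma min_coset_reps_iff: "x \<in> W\<^sup>J \<longleftrightarrow> x \<in> carrier G \<and> inv x \<in> minimal_reps H"
proof -
  have "len x < len (x \<otimes> s) \<longleftrightarrow> s \<notin> N (inv x)" if x: "x \<in> carrier G" and s: "s \<in> J" for s
  proof -
    have sS: "s \<in> S" using s J_subset by blast
    then have "len (s \<otimes> inv x) = len (x \<otimes> s)"
      using x len_inv_S [of "x \<otimes> s"] by (simp add: inv_mult_group)
    then show ?thesis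
      using not_left_inversion_iff [OF S_reflection [OF sS], of "inv x"] x len_inv_S by simp
  qed
  then show ?thesis by (auto simp: min_coset_reps_def minimal_reps_iff)
qed

lemma len_min_coset_rep_mult:
  assumes x: "x \<in> W\<^sup>J" and y: "y \<in> H"
  shows "len (x \<otimes> y) = len x + len y"
proof -
  have xc: "x \<in> carrier G" "inv x \<in> minimal_reps H"
    using x by (simp_all add: min_coset_reps_iff)
  have "len (x \<otimes> y) = len (inv y \<otimes> inv x)"
    using xc y len_inv_S [of "x \<otimes> y"] by (simp add: inv_mult_group)
  also have "\<dots> = len (inv y) + len (inv x)"
    using len_mult_minimal_rep [OF _ xc(2), of "inv y"] gens_len_eq_len [of "inv y"] y by simp
  finally show ?thesis using xc y by (simp add: len_inv_S)
qed

lemma min_coset_rep_unique: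
  assumes x: "x \<in> W\<^sup>J" "x' \<in> W\<^sup>J" and y: "y \<in> H" "y' \<in> H" and eq: "x \<otimes> y = x' \<otimes> y'"
  shows "x = x'"
proof -
  have xc: "x \<in> carrier G" "x' \<in> carrier G"
    and min: "inv x \<in> minimal_reps H" "inv x' \<in> minimal_reps H"
    using x by (simp_all add: min_coset_reps_iff)
  have "inv y \<otimes> inv x = inv y' \<otimes> inv x'"
    using arg_cong [OF eq, of "m_inv G"] xc y by (simp add: inv_mult_group)
  then have "y' \<otimes> inv y \<otimes> inv x = inv x'"
    using xc y by (simp add: m_assoc)
  moreover from this have "y' \<otimes> inv y = \<one>"
    using minimal_rep_unique [OF min(1), of "y' \<otimes> inv y"] min(2) y by simp
  ultimately show ?thesis using xc by (metis inv_closed inv_inv l_one)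
qed

lemma proj_J_mult:
  assumes "x \<in> W\<^sup>J" "y \<in> H"
  shows "P\<^sup>J (x \<otimes> y) = x"
  unfolding proj_J_def
  by (rule the_equality) (use assms len_min_coset_rep_mult min_coset_rep_unique in blast)+

lemma proj_J_factorization:
  assumes w: "w \<in> carrier G"
  obtains y where "y \<in> H" "P\<^sup>J w \<in> W\<^sup>J" "w = P\<^sup>J w \<otimes> y"
proof -
  obtain h z where h: "h \<in> H" and z: "z \<in> minimal_reps H" and hz: "inv w = h \<otimes> z"
    using coset_factorization [OF gens.generated_subgroup, of "inv w"] w
    unfolding canonical_gens_generate by auto
  have zc: "z \<in> carrier G" using z by (rule minimal_reps_closed)
  have "inv (inv w) = inv z \<otimes> inv h" unfolding hz using h zc by (simp add: inv_mult_group)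
  then have w_eq: "w = inv z \<otimes> inv h" using w by simp
  have min: "inv z \<in> W\<^sup>J" using z zc by (simp add: min_coset_reps_iff)
  then have "P\<^sup>J w = inv z" unfolding w_eq using h by (intro proj_J_mult) simp_all
  then show ?thesis using that [of "inv h"] h min w_eq by simp
qed

lemma proj_J_descend:
  assumes w: "w \<in> carrier G" and s: "s \<in> J"
  shows "P\<^sup>J (descend s w) = P\<^sup>J w"
proof -
  define x where "x = P\<^sup>J w"
  obtain y where y: "y \<in> H" and x: "x \<in> W\<^sup>J" and eq: "w = x \<otimes> y"
    using w unfolding x_def by (rule proj_J_factorization)
  have ys: "y \<otimes> s \<in> H" using y s by (simp add: generate.incl)
  have "w \<otimes> s = x \<otimes> (y \<otimes> s)"
    using x y s by (simp add: eq m_assoc min_coset_reps_iff)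
  then show ?thesis using proj_J_mult [OF x ys] by (simp add: descend_def x_def)
qed

lemma proj_J_id: "x \<in> W\<^sup>J \<Longrightarrow> P\<^sup>J x = x"
  using proj_J_mult [of x \<one>] by (simp add: min_coset_reps_iff)

lemma proj_J_mono:
  assumes R: "order_ideal_T G S R"
    and "u \<in> carrier G" "v \<in> carrier G" "le_LX G S R u v"
  shows "le_LX G S R (P\<^sup>J u) (P\<^sup>J v)"
  using assms(2-)
proof (induction "len u + len v" arbitrary: u v rule: less_induct)
  case less
  show ?case
  proof (cases "u \<in> W\<^sup>J \<and> v \<in> W\<^sup>J")
    case True
    then show ?thesis using less.prems(3) proj_J_id by simp
  next
    case False
    then obtain s where s: "s \<in> J" "\<not> len u < len (u \<otimes> s) \<or> \<not> len v < len (v \<otimes> s)"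
      using less.prems(1,2) by (auto simp: min_coset_reps_def)
    then have sS: "s \<in> S" using J_subset by blast
    have "len (descend s u) + len (descend s v) < len u + len v"
      using s(2) len_mult_S_neq [OF less.prems(1) sS] len_mult_S_neq [OF less.prems(2) sS]
      by (auto simp: descend_def)
    then have "le_LX G S R (P\<^sup>J (descend s u)) (P\<^sup>J (descend s v))"
      using less.prems sS by (intro less.hyps descend_closed descend_mono [OF R])
    then show ?thesis using less.prems s(1) by (simp add: proj_J_descend)
  qed
qed

end

theorem theorem3p8:
  fixes G :: "('a, 'b) monoid_scheme" and S J :: "'a set"
  assumes "coxeter_system G S" and "J \<subseteq> S"
  shows "(\<forall>R. order_ideal_T G S R \<longrightarrow>
            (\<forall>u \<in> carrier G. \<forall>v \<in> carrier G. le_LX G S R u v \<longrightarrow>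
               le_LX G S R (proj_J G S J u) (proj_J G S J v)))
       \<and> (\<forall>k::nat. \<forall>u \<in> carrier G. \<forall>v \<in> carrier G. le_Lk G S k u v \<longrightarrow>
               le_Lk G S k (proj_J G S J u) (proj_J G S J v))"
proof -
  interpret parabolic_subgroup G S J
    using assms by unfold_locales
  show ?thesis
    using proj_J_mono order_ideal_refl_T_k unfolding le_Lk_def by blast
qed

end
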